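(* Let $X$ be a standard Borel space, let $\Gamma$ be a Borel graph on $X$, and let $\rho$ be the graph metric on $\Gamma$. Assume that $\Gamma$ is locally finite and that $\mathrm{asdim}_{\mathbf{B}}(X,\rho)<\infty$. Then $\chi_{\mathbf{B}}(\Gamma)\le 2\cdot\chi(\Gamma)-1$.
   Context: A Borel graph on $X$ is a graph with vertex set $X$ whose edge set $\Gamma$ is a Borel subset of $X\times X$. The graph metric $\rho(x,y)$ is the least length of a path joining $x$ and $y$, and $+\infty$ if no such path exists. $\Gamma$ is locally finite if every vertex has finite degree. A proper coloring is a function $c:X\to Z$ such that adjacent vertices get different values. The chromatic number $\chi(\Gamma)$ is the least cardinality of a set $Z$ for which a proper coloring $c:X\to Z$ exists; the Borel chromatic number $\chi_{\mathbf{B}}(\Gamma)$ is defined in the same way but requiring $Z$ to be a standard Borel space and $c$ to be Borel. If $\chi(\Gamma)$ is infinite, the right-hand side is read as $\chi(\Gamma)$. $\mathrm{asdim}_{\mathbf{B}}(X,\rho)$ is the least $d\in\mathbb{N}$ such that for every $r>0$ there is a Borel equivalence relation $E$ on $X$, with a finite uniform bound on the $\rho$-diameters of its classes, such that every closed $\rho$-ball of radius $r$ meets at most $d+1$ classes of $E$; it is $\infty$ if no such $d$ exists. *)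

theory Defs
  imports "HOL-Analysis.Analysis"
begin

unbundle cardinal_syntax

text \<open>Only the \<open>\<sigma>\<close>-algebra of a \<^typ>\<open>'a measure\<close> matters below; its
  \<^const>\<open>emeasure\<close> is irrelevant.\<close>

definition standard_borel :: "'a measure \<Rightarrow> bool" where
  "standard_borel M \<longleftrightarrow>
     (\<exists>T. completely_metrizable_space T \<and> separable_space T \<and> topspace T = space M \<and>
          sets M = sigma_sets (space M) {U. openin T U})"

definition borel_graph :: "'a measure \<Rightarrow> ('a \<times> 'a) set \<Rightarrow> bool" where
  "borel_graph M \<Gamma> \<longleftrightarrow> \<Gamma> \<in> sets (M \<Otimes>\<^sub>M M) \<and> sym \<Gamma> \<and> irrefl \<Gamma>"

definition locally_finite_graph :: "'a set \<Rightarrow> ('a \<times> 'a) set \<Rightarrow> bool" where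
  "locally_finite_graph V \<Gamma> \<longleftrightarrow> (\<forall>x\<in>V. finite {y. (x, y) \<in> \<Gamma>})"

text \<open>\<open>(x, y) \<in> \<Gamma> ^^ n\<close> says that a walk of length \<open>n\<close> leads from \<open>x\<close> to \<open>y\<close>.
  A shortest walk is a path. The infimum of the empty set in \<^typ>\<open>ennreal\<close> is \<open>\<infinity>\<close>.\<close>

definition graph_metric :: "('a \<times> 'a) set \<Rightarrow> 'a \<Rightarrow> 'a \<Rightarrow> ennreal" where
  "graph_metric \<Gamma> x y = (INF n\<in>{n. (x, y) \<in> \<Gamma> ^^ n}. of_nat n)"

definition ext_diameter :: "('a \<Rightarrow> 'a \<Rightarrow> ennreal) \<Rightarrow> 'a set \<Rightarrow> ennreal" where
  "ext_diameter \<rho> C = (SUP (x, y)\<in>C \<times> C. \<rho> x y)"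

definition borel_equiv :: "'a measure \<Rightarrow> ('a \<times> 'a) set \<Rightarrow> bool" where
  "borel_equiv M E \<longleftrightarrow> equiv (space M) E \<and> E \<in> sets (M \<Otimes>\<^sub>M M)"

definition borel_asdim_le :: "'a measure \<Rightarrow> ('a \<Rightarrow> 'a \<Rightarrow> ennreal) \<Rightarrow> nat \<Rightarrow> bool" where
  "borel_asdim_le M \<rho> d \<longleftrightarrow>
     (\<forall>r::real. r > 0 \<longrightarrow>
       (\<exists>E. borel_equiv M E \<and>
            (\<exists>D<\<infinity>. \<forall>C \<in> space M // E. ext_diameter \<rho> C \<le> D) \<and>
            (\<forall>x \<in> space M.
               let meets = {C \<in> space M // E. C \<inter> {y \<in> space M. \<rho> x y \<le> ennreal r} \<noteq> {}}
               in finite meets \<and> card meets \<le> d + 1)))"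

definition borel_asdim :: "'a measure \<Rightarrow> ('a \<Rightarrow> 'a \<Rightarrow> ennreal) \<Rightarrow> enat" where
  "borel_asdim M \<rho> = (INF d\<in>{d. borel_asdim_le M \<rho> d}. enat d)"

definition proper_coloring :: "'a set \<Rightarrow> ('a \<times> 'a) set \<Rightarrow> 'b set \<Rightarrow> ('a \<Rightarrow> 'b) \<Rightarrow> bool" where
  "proper_coloring V \<Gamma> Z c \<longleftrightarrow> c \<in> V \<rightarrow> Z \<and> (\<forall>(x, y)\<in>\<Gamma>. c x \<noteq> c y)"

text \<open>A cardinal is represented, up to \<open>=o\<close>, by a cardinal order. This picks a
  \<open>\<le>o\<close>-least member of a nonempty set of cardinal orders.\<close>

definition least_cardinal :: "'a rel set \<Rightarrow> 'a rel" where
  "least_cardinal R = (SOME r. r \<in> R \<and> (\<forall>r'\<in>R. r \<le>o r'))"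

text \<open>In the next two definitions the sets of colors range over one type only, which has to
  be fixed for the minimum to be an object of the logic; the type of the vertices is large
  enough. The lemmas \<open>chromatic_number_le\<close> and \<open>borel_chromatic_number_le\<close> below show that the
  resulting cardinals are minimal among sets of colors of every type.\<close>

definition chromatic_number :: "'a set \<Rightarrow> ('a \<times> 'a) set \<Rightarrow> 'a rel" where
  "chromatic_number V \<Gamma> = least_cardinal {|Z| | Z::'a set. \<exists>c. proper_coloring V \<Gamma> Z c}"

definition borel_chromatic_number :: "'a measure \<Rightarrow> ('a \<times> 'a) set \<Rightarrow> 'a rel" where
  "borel_chromatic_number M \<Gamma> = least_cardinal
     {|space N| | N::'a measure. standard_borel N \<and>
        (\<exists>c \<in> M \<rightarrow>\<^sub>M N. proper_coloring (space M) \<Gamma> (space N) c)}"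

lemma least_cardinal:
  assumes "R \<noteq> {}" "\<And>r. r \<in> R \<Longrightarrow> Card_order r"
  shows "least_cardinal R \<in> R" "r \<in> R \<Longrightarrow> least_cardinal R \<le>o r"
proof -
  have "\<exists>r. r \<in> R \<and> (\<forall>r'\<in>R. r \<le>o r')"
    using exists_minim_Card_order[of R] assms by blast
  then have "least_cardinal R \<in> R \<and> (\<forall>r'\<in>R. least_cardinal R \<le>o r')"
    unfolding least_cardinal_def by (rule someI_ex)
  then show "least_cardinal R \<in> R" "r \<in> R \<Longrightarrow> least_cardinal R \<le>o r" by auto
qed

lemma chromatic_number_attained:
  assumes "\<Gamma> \<subseteq> V \<times> V" "irrefl \<Gamma>"
  shows "\<exists>Z c. chromatic_number V \<Gamma> = |Z| \<and> proper_coloring V \<Gamma> Z c"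
proof -
  have "proper_coloring V \<Gamma> V id"
    using assms by (auto simp: proper_coloring_def irrefl_on_def)
  then have "chromatic_number V \<Gamma> \<in> {|Z| | Z::'a set. \<exists>c. proper_coloring V \<Gamma> Z c}"
    unfolding chromatic_number_def by (intro least_cardinal(1)) (auto simp: card_of_Card_order)
  then show ?thesis by auto
qed

lemma chromatic_number_le:
  assumes "\<Gamma> \<subseteq> V \<times> V" "proper_coloring V \<Gamma> (Z::'b set) c"
  shows "chromatic_number V \<Gamma> \<le>o |Z|"
proof -
  let ?g = "inv_into V c"
  have "proper_coloring V \<Gamma> (?g ` c ` V) (?g \<circ> c)"
    unfolding proper_coloring_def
  proof (intro conjI)
    show "\<forall>(x, y)\<in>\<Gamma>. (?g \<circ> c) x \<noteq> (?g \<circ> c) y"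
    proof clarify
      fix x y assume xy: "(x, y) \<in> \<Gamma>" and eq: "(?g \<circ> c) x = (?g \<circ> c) y"
      from xy assms(1) have "c x \<in> c ` V" "c y \<in> c ` V" by auto
      with eq have "c x = c y" using inv_into_injective by fastforce
      with xy assms(2) show False by (auto simp: proper_coloring_def)
    qed
  qed auto
  then have "chromatic_number V \<Gamma> \<le>o |?g ` c ` V|"
    unfolding chromatic_number_def by (intro least_cardinal(2)) (auto simp: card_of_Card_order)
  also have "|?g ` c ` V| \<le>o |c ` V|" by (rule card_of_image)
  also have "|c ` V| \<le>o |Z|"
    using assms(2) by (intro card_of_mono1) (auto simp: proper_coloring_def)
  finally show ?thesis .
qed

lemma borel_chromatic_number_attained:
  assumes "standard_borel M" "\<Gamma> \<subseteq> space M \<times> space M" "irrefl \<Gamma>"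
  shows "\<exists>N c. borel_chromatic_number M \<Gamma> = |space N| \<and> standard_borel N \<and> c \<in> M \<rightarrow>\<^sub>M N \<and>
           proper_coloring (space M) \<Gamma> (space N) c"
proof -
  let ?R = "{|space N| | N::'a measure. standard_borel N \<and>
        (\<exists>c \<in> M \<rightarrow>\<^sub>M N. proper_coloring (space M) \<Gamma> (space N) c)}"
  have "proper_coloring (space M) \<Gamma> (space M) id"
    using assms by (auto simp: proper_coloring_def irrefl_on_def)
  then have "|space M| \<in> ?R"
    using assms(1) measurable_ident[of M] by (auto intro!: exI[of _ M] bexI[of _ id])
  then have "borel_chromatic_number M \<Gamma> \<in> ?R"
    unfolding borel_chromatic_number_def by (intro least_cardinal(1)) (auto simp: card_of_Card_order)
  then show ?thesis by auto
qed

lemma standard_borel_embed_measure: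
  assumes "standard_borel N" "inj_on f (space N)"
  shows "standard_borel (embed_measure N f)"
proof -
  from assms(1) obtain T where T: "completely_metrizable_space T" "separable_space T"
    "topspace T = space N" "sets N = sigma_sets (space N) {U. openin T U}"
    unfolding standard_borel_def by blast
  let ?g = "inv_into (space N) f"
  define S where "S = pullback_topology (f ` space N) ?g T"
  have im: "?g -` U \<inter> f ` space N = f ` U" if "U \<subseteq> space N" for U
    using that inv_into_f_f[OF assms(2)] by (fastforce simp: subset_iff)
  have op: "openin S W \<longleftrightarrow> (\<exists>U. openin T U \<and> W = f ` U)" for W
  proof -
    have "?g -` U \<inter> f ` space N = f ` U" if "openin T U" for U
      using im openin_subset[OF that] T(3) by simp
    then show ?thesis unfolding S_def openin_pullback_topology by (intro ex_cong) auto
  qed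
  have tS: "topspace S = f ` space N"
    unfolding S_def topspace_pullback_topology T(3) using im[of "space N"] by simp
  have "homeomorphic_map T S f"
  proof (rule bijective_open_imp_homeomorphic_map)
    show "f ` topspace T = topspace S" "inj_on f (topspace T)" using T(3) tS assms(2) by auto
    show "open_map T S f" unfolding open_map_def op by blast
    show "continuous_map T S f" unfolding continuous_map_def
    proof (intro conjI allI impI)
      show "f \<in> topspace T \<rightarrow> topspace S" using T(3) tS by auto
      fix W assume "openin S W"
      then obtain U where U: "openin T U" "W = f ` U" using op by blast
      then have "{x \<in> topspace T. f x \<in> W} = U"
        using openin_subset[OF U(1)] T(3) assms(2) by (auto dest: inj_onD)
      then show "openin T {x \<in> topspace T. f x \<in> W}" using U(1) by simp
    qed
  qed
  then have h: "T homeomorphic_space S"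
    using homeomorphic_map_imp_homeomorphic_space by blast
  have "sets (embed_measure N f) = (`) f ` sigma_sets (space N) {U. openin T U}"
    unfolding sets_embed_measure'[OF assms(2)] T(4) by auto
  also have "\<dots> = sigma_sets (f ` space N) {U. openin S U}"
  proof (intro equalityI subsetI)
    fix W assume "W \<in> (`) f ` sigma_sets (space N) {U. openin T U}"
    then obtain A where A: "W = f ` A" "A \<in> sigma_sets (space N) {U. openin T U}" by auto
    from A(2) have "f ` A \<in> sigma_sets (f ` space N) {U. openin S U}"
    proof induction
      case (Basic a)
      then show ?case using op by auto
    next
      case Empty
      then show ?case by (simp add: sigma_sets.Empty)
    next
      case (Compl a)
      then have "a \<subseteq> space N" using sets.sets_into_space[of a N] T(4) by auto
      then have "f ` (space N - a) = f ` space N - f ` a"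
        using assms(2) by (intro inj_on_image_set_diff) auto
      then show ?case using Compl sigma_sets.Compl by metis
    next
      case (Union a)
      then show ?case unfolding image_UN by (intro sigma_sets.Union) auto
    qed
    then show "W \<in> sigma_sets (f ` space N) {U. openin S U}" using A by simp
  next
    fix W assume "W \<in> sigma_sets (f ` space N) {U. openin S U}"
    then have "W \<in> sets (embed_measure N f)"
    proof induction
      case (Basic a)
      then obtain U where "openin T U" "a = f ` U" using op by auto
      then show ?case using in_sets_embed_measure[of U N f] T(4) by auto
    next
      case (Compl a)
      then show ?case using sets.compl_sets space_embed_measure by metis
    qed auto
    then show "W \<in> (`) f ` sigma_sets (space N) {U. openin T U}"
      unfolding sets_embed_measure'[OF assms(2)] T(4) by auto
  qed
  finally show ?thesis
    unfolding standard_borel_def space_embed_measure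
    using T(1,2) h tS homeomorphic_completely_metrizable_space homeomorphic_separable_space
    by blast
qed

lemma borel_chromatic_number_le:
  fixes N :: "'b measure"
  assumes "standard_borel M" "\<Gamma> \<subseteq> space M \<times> space M" "standard_borel N"
    and "c \<in> M \<rightarrow>\<^sub>M N" "proper_coloring (space M) \<Gamma> (space N) c"
  shows "borel_chromatic_number M \<Gamma> \<le>o |space N|"
proof -
  let ?R = "{|space N| | N::'a measure. standard_borel N \<and>
        (\<exists>c \<in> M \<rightarrow>\<^sub>M N. proper_coloring (space M) \<Gamma> (space N) c)}"
  have least: "borel_chromatic_number M \<Gamma> \<le>o r" if "r \<in> ?R" for r
    using that unfolding borel_chromatic_number_def by (intro least_cardinal(2)) (auto simp: card_of_Card_order)
  consider "|space N| \<le>o |space M|" | "|space M| \<le>o |space N|"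
    using ordLeq_total[OF card_of_Well_order card_of_Well_order] by blast
  then show ?thesis
  proof cases
    case 1
    then obtain f where f: "inj_on f (space N)" "f ` space N \<subseteq> space M"
      using card_of_ordLeq[of "space N" "space M"] by blast
    have "proper_coloring (space M) \<Gamma> (f ` space N) (f \<circ> c)"
      unfolding proper_coloring_def
    proof (intro conjI)
      show "\<forall>(x, y)\<in>\<Gamma>. (f \<circ> c) x \<noteq> (f \<circ> c) y"
      proof clarify
        fix x y assume xy: "(x, y) \<in> \<Gamma>" and eq: "(f \<circ> c) x = (f \<circ> c) y"
        from xy assms(2,5) have "c x \<in> space N" "c y \<in> space N"
          by (auto simp: proper_coloring_def)
        with eq f(1) have "c x = c y" by (auto dest: inj_onD)
        with xy assms(5) show False by (auto simp: proper_coloring_def)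
      qed
    qed (use assms(5) in \<open>auto simp: proper_coloring_def\<close>)
    moreover have "f \<circ> c \<in> M \<rightarrow>\<^sub>M embed_measure N f"
      using assms(4) measurable_embed_measure2'[OF f(1)] by (rule measurable_comp)
    ultimately have "|space (embed_measure N f)| \<in> ?R"
      using standard_borel_embed_measure[OF assms(3) f(1)]
      by (auto simp: space_embed_measure intro!: exI[of _ "embed_measure N f"])
    from least[OF this] have "borel_chromatic_number M \<Gamma> \<le>o |f ` space N|"
      by (simp add: space_embed_measure)
    from ordLeq_transitive[OF this card_of_image] show ?thesis .
  next
    case 2
    have "proper_coloring (space M) \<Gamma> (space M) id"
      using assms(2,5) by (auto simp: proper_coloring_def)
    then have "|space M| \<in> ?R"
      using assms(1) measurable_ident[of M] by (auto intro!: exI[of _ M] bexI[of _ id])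
    from ordLeq_transitive[OF least[OF this] 2] show ?thesis .
  qed
qed

end

theory Submission
  imports Defs
begin

text \<open>Let \<open>E\<^sub>0 \<subseteq> E\<^sub>1 \<subseteq> \<dots>\<close> be Borel equivalence relations with bounded classes such that a ball whose
  radius is large compared to the classes of \<open>E\<^sub>n\<^sub>-\<^sub>1\<close> meets at most \<open>d + 1\<close> classes of \<open>E\<^sub>n\<close>. The
  number of \<open>E\<^sub>n\<close>-classes met by a ball around \<open>x\<close> decreases with \<open>n\<close> and increases with the radius;
  its limit depends only on the component of \<open>x\<close>. Fix for each \<open>x\<close> the first radius at which the limit
  is reached, and put two points in the same cell of level \<open>n\<close> if their balls of that radius meet the
  same \<open>E\<^sub>n\<close>-classes. The cells are finite and exhaust the component even if it consists of several
  classes of \<open>\<Union>n. E\<^sub>n\<close>.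

  A neighbourhood of the cell of \<open>x\<close> of level \<open>i\<close> is absorbed by the cell of \<open>x\<close> at a later time. This
  time is determined by the \<open>E\<^sub>n\<close>-classes which the neighbourhood meets. For \<open>i < n\<close> these sets of classes
  form a chain of sets of size at most \<open>d + 1\<close>, so at most \<open>d + 1\<close> absorption times are pending at any
  moment. Hence only boundedly many of the cells of levels at which the absorption time jumps share a
  piece of boundary, and these cells shrink to finite cores, any two of which are nested or disjoint with
  a gap between their boundaries. Every point lies in a core. Therefore both the union of the boundaries
  of the cores, even thickened by one step, and its complement have finite components.

  A Borel graph with finite components has a Borel coloring with the least possible number \<open>k\<close> of colors.
  The colorings of the two parts can share one color, which gives \<open>2k - 1\<close> colors. All sets are Borel
  because a Borel set with finite sections has a Borel projection, by Novikov's separation theorem.\<close>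

section \<open>Borel projections along closed sections\<close>

lemma countable_cover_small_closed:
  fixes e :: real
  assumes "e > 0"
  shows "\<exists>U :: nat \<Rightarrow> 'a::{complete_space,second_countable_topology} set. (\<forall>i. closed (U i) \<and> (\<forall>x\<in>U i. \<forall>y\<in>U i. dist x y < e)) \<and> (\<Union>i. U i) = UNIV"
proof -
  obtain D :: "'a set" where D: "countable D" "\<And>X. open X \<Longrightarrow> X \<noteq> {} \<Longrightarrow> \<exists>d\<in>D. d \<in> X"
    using countable_dense_setE by blast
  have ne: "D \<noteq> {}" using D(2)[of UNIV] by auto
  define U where "U i = cball (from_nat_into D i) (e/3)" for i
  have "\<exists>i. x \<in> U i" for x
  proof -
    obtain d where "d \<in> D" "d \<in> ball x (e/3)" using D(2)[of "ball x (e/3)"] assms by auto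
    then show ?thesis using from_nat_into_surj[OF D(1), of d] 
      by (auto simp: U_def dist_commute intro!: less_imp_le)
  qed
  moreover have "dist x y < e" if "x \<in> U i" "y \<in> U i" for x y i
  proof -
    have "dist x y \<le> dist (from_nat_into D i) x + dist (from_nat_into D i) y" by (metis dist_commute dist_triangle)
    with that assms show ?thesis by (simp add: U_def)
  qed
  ultimately show ?thesis by (intro exI[of _ U]) (auto simp: U_def)
qed

text \<open>Novikov's notion for a whole sequence of sets. Letting all but two of them be the whole
  space gives Lusin's separation of two disjoint sets, a form that is used below as well.\<close>

definition borel_separated :: "(nat \<Rightarrow> 'a::topological_space set) \<Rightarrow> bool" where
  "borel_separated A \<longleftrightarrow> (\<exists>B. (\<forall>n. B n \<in> sets borel \<and> A n \<subseteq> B n) \<and> (\<Inter>n. B n) = {})"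

text \<open>Take the union over the pieces at index \<open>m\<close> and the intersection over the
  pieces at every other index. A common point would lie in \<open>B i m\<close> for one
  \<open>i\<close>, and then in all sets of the \<open>i\<close>-th separation.\<close>

lemma borel_separated_UN:
  assumes "\<And>i::nat. borel_separated (A(m := D i))" "A m \<subseteq> (\<Union>i. D i)"
  shows "borel_separated A"
proof -
  from assms(1) obtain B where B: "\<And>i n. B i n \<in> sets borel" "\<And>i n. (A(m := D i)) n \<subseteq> B i n"
    "\<And>i. (\<Inter>n. B i n) = {}"
    unfolding borel_separated_def by metis
  define B' where "B' n = (if n = m then (\<Union>i. B i m) else (\<Inter>i. B i n))" for n
  have "B' n \<in> sets borel" for n unfolding B'_def using B(1) by auto
  moreover have "A n \<subseteq> B' n" for n
  proof (cases "n = m")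
    case True
    have "D i \<subseteq> B i m" for i using B(2)[where i=i and n=m] by simp
    with True assms(2) show ?thesis by (fastforce simp: B'_def)
  next
    case False
    then show ?thesis using B(2)[where n=n] by (auto simp: B'_def)
  qed
  moreover have "(\<Inter>n. B' n) = {}"
  proof (rule ccontr)
    assume "(\<Inter>n. B' n) \<noteq> {}"
    then obtain x where x: "\<And>n. x \<in> B' n" by blast
    then obtain i where "x \<in> B i m" using x[of m] by (auto simp: B'_def)
    then have "x \<in> B i n" for n using x[of n] by (cases "n = m") (auto simp: B'_def)
    then show False using B(3)[of i] by blast
  qed
  ultimately show ?thesis unfolding borel_separated_def by blast
qed

text \<open>If the sets were not separated, some piece of a given countable cover of any one of them
  could replace it without making them separated. Replacing the sets in turn by pieces of smaller
  and smaller diameter, one reaches a sequence of points whose images cannot all agree.\<close>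

lemma borel_separated_closed:
  fixes C :: "nat \<Rightarrow> 'c::{complete_space,second_countable_topology} set" and f :: "'c \<Rightarrow> 'a::t2_space"
  assumes f: "continuous_on UNIV f" and cl: "\<And>n. closed (C n)" and dis: "(\<Inter>n. f ` C n) = {}"
  shows "borel_separated (\<lambda>n. f ` C n)"
proof (rule ccontr)
  assume ns: "\<not> ?thesis"
  define good where "good K \<longleftrightarrow> (\<forall>n. closed (K n)) \<and> \<not> borel_separated (\<lambda>n. f ` K n)" for K :: "nat \<Rightarrow> 'c set"
  define small where "small e X \<longleftrightarrow> (\<forall>x\<in>X. \<forall>y\<in>X. dist x y < e)" for e :: real and X :: "'c set"
  have step: "\<exists>K'. good K' \<and> (\<forall>n. K' n \<subseteq> K n) \<and> small e (K' m)" if K: "good K" "e > 0" for K e m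
  proof -
    obtain U :: "nat \<Rightarrow> 'c set" where U: "\<And>i. closed (U i)" "\<And>i. small e (U i)" "(\<Union>i. U i) = UNIV"
      using countable_cover_small_closed[OF \<open>e > 0\<close>, where ?'a='c] unfolding small_def by metis
    obtain i where i: "\<not> borel_separated ((\<lambda>n. f ` K n)(m := f ` (K m \<inter> U i)))"
    proof (rule ccontr)
      assume "\<not> thesis"
      with that have "\<And>i. borel_separated ((\<lambda>n. f ` K n)(m := f ` (K m \<inter> U i)))" by blast
      moreover have "f ` K m \<subseteq> (\<Union>i. f ` (K m \<inter> U i))" using U(3) by blast
      ultimately have "borel_separated (\<lambda>n. f ` K n)" by (rule borel_separated_UN)
      with K show False by (auto simp: good_def)
    qed
    define K' where "K' = K(m := K m \<inter> U i)"
    have "(\<lambda>n. f ` K' n) = (\<lambda>n. f ` K n)(m := f ` (K m \<inter> U i))" by (auto simp: K'_def fun_eq_iff)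
    then have "\<not> borel_separated (\<lambda>n. f ` K' n)" using i by simp
    moreover have "closed (K' n)" for n using K(1) U(1) by (auto simp: K'_def good_def)
    ultimately have "good K'" by (simp add: good_def)
    then show ?thesis using U(2)[of i] by (intro exI[of _ K']) (auto simp: K'_def small_def)
  qed
  \<comment> \<open>Stage \<open>k\<close> shrinks the set of index
    \<open>fst (prod_decode k)\<close> below diameter \<open>1 / Suc (snd (prod_decode k))\<close>.
    The pairing makes every set reach every precision.\<close>
  obtain K where K: "\<And>k. good (K k)" "\<And>k n. K (Suc k) n \<subseteq> K k n"
    "\<And>k. small (1 / Suc (snd (prod_decode k))) (K (Suc k) (fst (prod_decode k)))" and K0: "K 0 = C"
  proof -
    have "\<exists>K. \<forall>k. (good (K k) \<and> (k = 0 \<longrightarrow> K k = C)) \<and> ((\<forall>n. K (Suc k) n \<subseteq> K k n) \<and>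
       small (1 / Suc (snd (prod_decode k))) (K (Suc k) (fst (prod_decode k))))"
    proof (rule dependent_nat_choice)
      show "\<exists>K. good K \<and> (0 = (0::nat) \<longrightarrow> K = C)" using ns cl by (auto simp: good_def)
      show "\<exists>K'. (good K' \<and> (Suc k = 0 \<longrightarrow> K' = C)) \<and> (\<forall>n. K' n \<subseteq> K n) \<and>
            small (1 / Suc (snd (prod_decode k))) (K' (fst (prod_decode k)))" 
        if "good K \<and> (k = 0 \<longrightarrow> K = C)" for K k
        using step[of K "1 / Suc (snd (prod_decode k))" "fst (prod_decode k)"] that by auto
    qed
    then obtain K where K: "\<forall>k. (good (K k) \<and> (k = 0 \<longrightarrow> K k = C)) \<and> ((\<forall>n. K (Suc k) n \<subseteq> K k n) \<and>
       small (1 / Suc (snd (prod_decode k))) (K (Suc k) (fst (prod_decode k))))" ..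
    show ?thesis
    proof (rule that[of K])
      show "K 0 = C" using K by blast
    qed (use K in auto)
  qed
  have mono: "K k' n \<subseteq> K k n" if "k \<le> k'" for k k' n
    using that by (induction k' rule: dec_induct) (use K(2) in auto)
  have ne: "K k n \<noteq> {}" for k n
  proof
    assume e: "K k n = {}"
    have "borel_separated (\<lambda>m. f ` K k m)"
      unfolding borel_separated_def
      by (rule exI[of _ "\<lambda>m. if m = n then {} else UNIV"]) (use e in auto)
    with K(1)[of k] show False by (auto simp: good_def)
  qed
  have "\<exists>a. \<forall>k. a \<in> K k n" for n
  proof -
    have diam: "\<exists>k. \<forall>x\<in>K k n. \<forall>y\<in>K k n. dist x y < e" if e: "e > 0" for e
    proof -
      obtain j where j: "1 / Suc j < e" by (rule nat_approx_posE[OF e])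
      have "small (1 / Suc j) (K (Suc (prod_encode (n, j))) n)"
        using K(3)[of "prod_encode (n, j)"] by simp
      with j show ?thesis unfolding small_def by (meson less_trans)
    qed
    show ?thesis
    proof (rule decreasing_closed_nest[of "\<lambda>k. K k n"])
      show "closed (K k n)" for k using K(1) by (auto simp: good_def)
    qed (use ne mono diam in blast)+
  qed
  then obtain a where a: "\<And>k n. a n \<in> K k n" by metis
  have "\<exists>n. f (a n) \<noteq> f (a 0)"
  proof (rule ccontr)
    assume "\<not> ?thesis"
    then have "\<And>n. f (a 0) \<in> f ` C n" using a[of _ 0] K0 by (metis image_eqI)
    with dis show False by blast
  qed
  then obtain n where n: "f (a n) \<noteq> f (a 0)" by blast
  then obtain U V where UV: "open U" "open V" "f (a n) \<in> U" "f (a 0) \<in> V" "U \<inter> V = {}"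
    using hausdorff by metis
  have sub: "\<exists>k. \<forall>k'\<ge>k. f ` K k' m \<subseteq> W" if W: "open W" "f (a m) \<in> W" for m W
  proof -
    have "open (f -` W)" using f W(1) by (simp add: continuous_on_open_vimage)
    then obtain e where e: "e > 0" "ball (a m) e \<subseteq> f -` W" using W(2) open_contains_ball by (metis vimageI)
    obtain j where j: "1 / Suc j < e" by (rule nat_approx_posE[OF e(1)])
    have "small (1 / Suc j) (K (Suc (prod_encode (m, j))) m)"
      using K(3)[of "prod_encode (m, j)"] by simp
    then have "K (Suc (prod_encode (m, j))) m \<subseteq> ball (a m) e"
      using a[where n=m] j unfolding small_def by fastforce
    with e(2) mono have "\<And>k'. k' \<ge> Suc (prod_encode (m, j)) \<Longrightarrow> K k' m \<subseteq> f -` W" by blast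
    then show ?thesis by blast
  qed
  obtain k1 k2 where k: "\<And>k'. k' \<ge> k1 \<Longrightarrow> f ` K k' n \<subseteq> U" "\<And>k'. k' \<ge> k2 \<Longrightarrow> f ` K k' 0 \<subseteq> V"
    using sub[OF UV(1,3)] sub[OF UV(2,4)] by blast
  \<comment> \<open>At this stage \<open>U\<close> and \<open>V\<close>, with the whole space at all
    other indices, separate the images, which contradicts \<open>good\<close>.\<close>
  let ?k = "max k1 k2"
  have "n \<noteq> 0" using n by metis
  then have "borel_separated (\<lambda>m. f ` K ?k m)"
    unfolding borel_separated_def
    using k[of ?k] UV
    by (intro exI[of _ "\<lambda>m. if m = n then U else if m = 0 then V else UNIV"]) (auto split: if_splits)
  with K(1)[of ?k] show False by (auto simp: good_def)
qed

text \<open>Projections of closed sets along the Polish space of real sequences contain the closed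
  and the open sets and are stable under countable unions and intersections.\<close>

lemma borel_eq_fst_image_closed:
  fixes A :: "'a::metric_space set"
  assumes "A \<in> sets borel"
  shows "\<exists>C :: ('a \<times> (nat \<Rightarrow> real)) set. closed C \<and> A = fst ` C"
proof -
  define proj where "proj A \<longleftrightarrow> (\<exists>C :: ('a \<times> (nat \<Rightarrow> real)) set. closed C \<and> A = fst ` C)" for A
  have coord: "continuous_on UNIV (\<lambda>p :: 'a \<times> (nat \<Rightarrow> real). snd p n)" for n
    by (rule continuous_on_compose2[OF continuous_on_product_coordinates[of n]])
      (auto intro: continuous_on_snd continuous_on_id)
  have cont: "continuous_on UNIV (\<lambda>p :: 'a \<times> (nat \<Rightarrow> real). (fst p, (\<lambda>k. snd p (h k))))" for h :: "nat \<Rightarrow> nat"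
    by (rule continuous_on_Pair[OF continuous_on_fst[OF continuous_on_id]
          continuous_on_coordinatewise_then_product[OF coord]])
  have union: "proj (\<Union>n::nat. A n)" if "\<And>n. proj (A n)" for A
  proof -
    from that obtain C :: "nat \<Rightarrow> ('a \<times> (nat \<Rightarrow> real)) set" where C: "\<And>n. closed (C n)" "\<And>n. A n = fst ` C n"
      unfolding proj_def by metis
    \<comment> \<open>The first coordinate of the real sequence encodes the index; a non-integral value
      belongs to both neighbouring indices.\<close>
    define D where "D = {p. 0 \<le> snd p 0} \<inter> (\<Inter>n. {p. 1 \<le> \<bar>snd p 0 - real n\<bar>} \<union> {p. (fst p, \<lambda>k. snd p (Suc k)) \<in> C n})"
    have c1: "closed {p. (fst p, \<lambda>k. snd p (Suc k)) \<in> C n}" for n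
      using closed_vimage[OF C(1) cont[of Suc], of n] by (simp add: vimage_def)
    have c2: "closed {p :: 'a \<times> (nat \<Rightarrow> real). 1 \<le> \<bar>snd p 0 - real n\<bar>}" for n
      by (intro closed_Collect_le continuous_intros coord)
    have c3: "closed {p :: 'a \<times> (nat \<Rightarrow> real). 0 \<le> snd p 0}"
      by (intro closed_Collect_le continuous_intros coord)
    have "closed D" unfolding D_def
      by (rule closed_Int[OF c3 closed_INT]) (rule ballI, rule closed_Un[OF c2 c1])
    moreover have "(\<Union>n. A n) = fst ` D"
    proof (intro equalityI subsetI)
      fix x assume "x \<in> (\<Union>n. A n)"
      then obtain n b where b: "(x, b) \<in> C n" using C(2) by fastforce
      have "(x, case_nat (real n) b) \<in> D"
        unfolding D_def
      proof (intro IntI INT_I)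
        fix m
        have "1 \<le> \<bar>real n - real m\<bar>" if "n \<noteq> m"
          using that by (cases "n < m") auto
        then show "(x, case_nat (real n) b) \<in> {p. 1 \<le> \<bar>snd p 0 - real m\<bar>} \<union> {p. (fst p, \<lambda>k. snd p (Suc k)) \<in> C m}"
          using b by (cases "n = m") auto
      qed auto
      then show "x \<in> fst ` D" by force
    next
      fix x assume "x \<in> fst ` D"
      then obtain b where b: "(x, b) \<in> D" by auto
      let ?n = "nat \<lfloor>b 0\<rfloor>"
      have "\<bar>b 0 - real ?n\<bar> < 1" using b unfolding D_def by simp linarith
      then have "(x, \<lambda>k. b (Suc k)) \<in> C ?n" using b unfolding D_def by (auto dest: spec[of _ ?n])
      then show "x \<in> (\<Union>n. A n)" using C(2) by force
    qed
    ultimately show ?thesis unfolding proj_def by blast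
  qed
  have inter: "proj (\<Inter>n::nat. A n)" if "\<And>n. proj (A n)" for A
  proof -
    from that obtain C :: "nat \<Rightarrow> ('a \<times> (nat \<Rightarrow> real)) set" where C: "\<And>n. closed (C n)" "\<And>n. A n = fst ` C n"
      unfolding proj_def by metis
    \<comment> \<open>A single sequence codes countably many witnesses: the \<open>n\<close>-th one
      sits at the places \<open>prod_encode (n, k)\<close>.\<close>
    define D where "D = (\<Inter>n. {p. (fst p, \<lambda>k. snd p (prod_encode (n, k))) \<in> C n})"
    have "closed D" unfolding D_def
      using closed_vimage[OF C(1) cont] by (intro closed_INT ballI) (auto simp: vimage_def)
    moreover have "(\<Inter>n. A n) = fst ` D"
    proof (intro equalityI subsetI)
      fix x assume "x \<in> (\<Inter>n. A n)"
      then have "\<forall>n. \<exists>b. (x, b) \<in> C n" using C(2) by fastforce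
      then obtain b where b: "\<And>n. (x, b n) \<in> C n" by metis
      have "(x, \<lambda>m. b (fst (prod_decode m)) (snd (prod_decode m))) \<in> D" unfolding D_def using b by simp
      then show "x \<in> fst ` D" by force
    next
      fix x assume "x \<in> fst ` D"
      then show "x \<in> (\<Inter>n. A n)" unfolding D_def C(2) by force
    qed
    ultimately show ?thesis unfolding proj_def by blast
  qed
  have proj_closed: "proj X" if "closed X" for X
    unfolding proj_def using that by (intro exI[of _ "X \<times> UNIV"]) (auto simp: closed_Times)
  have proj_open: "proj X" if "open X" for X
  proof (cases "X = UNIV")
    case True then show ?thesis using proj_closed by simp
  next
    case False
    then have ne: "- X \<noteq> {}" by auto
    have "X = (\<Union>n::nat. {x. 1 / Suc n \<le> infdist x (- X)})"
    proof (intro equalityI subsetI)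
      fix x assume "x \<in> X"
      then have "infdist x (- X) > 0"
        using that ne in_closed_iff_infdist_zero[of "- X" x] infdist_nonneg[of x "- X"] by force
      from nat_approx_posE[OF this] obtain n where "1 / Suc n < infdist x (- X)" .
      then show "x \<in> (\<Union>n::nat. {x. 1 / Suc n \<le> infdist x (- X)})" by (auto intro: less_imp_le)
    next
      fix x assume "x \<in> (\<Union>n::nat. {x. 1 / Suc n \<le> infdist x (- X)})"
      then obtain n where "1 / Suc n \<le> infdist x (- X)" by auto
      then have "infdist x (- X) \<noteq> 0" by (auto simp: divide_le_0_iff)
      then show "x \<in> X" using infdist_zero by force
    qed
    moreover have "proj {x. 1 / Suc n \<le> infdist x (- X)}" for n
      by (intro proj_closed closed_Collect_le continuous_intros)
    ultimately show ?thesis using union[of "\<lambda>n. {x. 1 / Suc n \<le> infdist x (- X)}"] by simp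
  qed
  have "A \<in> sigma_sets UNIV {S. open S}" using assms by (simp add: borel_def)
  \<comment> \<open>Such projections need not be stable under complements, so the induction treats a
    set and its complement together.\<close>
  then have "proj A \<and> proj (- A)"
  proof induction
    case (Basic a)
    then show ?case using proj_closed proj_open by auto
  next
    case Empty
    then show ?case using proj_closed by simp
  next
    case (Compl a)
    then show ?case by (simp add: Compl_eq_Diff_UNIV[symmetric])
  next
    case (Union a)
    then show ?case using union inter by (simp add: Compl_UN)
  qed
  then show ?thesis unfolding proj_def by blast
qed

text \<open>A continuous image of a Borel set is also a continuous image of a closed set in a larger
  Polish space, so the closed case applies.\<close>

lemma borel_separated_borel:
  fixes C :: "nat \<Rightarrow> 'c::{complete_space,second_countable_topology} set" and f :: "'c \<Rightarrow> 'a::t2_space"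
  assumes f: "continuous_on UNIV f" and C: "\<And>n. C n \<in> sets borel" and dis: "(\<Inter>n. f ` C n) = {}"
  shows "borel_separated (\<lambda>n. f ` C n)"
proof -
  obtain D :: "nat \<Rightarrow> ('c \<times> (nat \<Rightarrow> real)) set" where D: "\<And>n. closed (D n)" "\<And>n. C n = fst ` D n"
    using borel_eq_fst_image_closed[OF C] by metis
  have eq: "f ` C n = (f \<circ> fst) ` D n" for n by (simp add: D(2) image_comp)
  have "continuous_on UNIV (f \<circ> fst :: 'c \<times> (nat \<Rightarrow> real) \<Rightarrow> 'a)"
    by (intro continuous_on_compose continuous_on_subset[OF f] continuous_intros) auto
  from borel_separated_closed[OF this D(1)] dis show ?thesis unfolding eq by simp
qed

text \<open>For sections inside a fixed interval, separation covers the complement of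
  \<open>P\<close> by rectangles \<open>X n \<times> V n\<close> that miss \<open>P\<close>, with
  \<open>X n\<close> Borel and \<open>V n\<close> open. By compactness \<open>x\<close> avoids the
  projection iff finitely many \<open>V n\<close> with \<open>x\<close> in \<open>X n\<close> cover
  the interval, which is a countable Borel condition. The general case is a union over
  intervals.\<close>

lemma borel_fst_image_closed_sections:
  fixes P :: "('a::{complete_space,second_countable_topology} \<times> real) set"
  assumes P: "P \<in> sets borel" and sec: "\<And>x. closed {y. (x, y) \<in> P}"
  shows "fst ` P \<in> sets borel"
proof -
  have bounded: "fst ` P \<in> sets borel" if P: "P \<in> sets borel" and sec: "\<And>x. closed {y. (x, y) \<in> P}"
      and PN: "P \<subseteq> UNIV \<times> {-N..N}" for P :: "('a \<times> real) set" and N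
  proof -
    obtain \<B> :: "real set set" where \<B>: "countable \<B>" "topological_basis \<B>"
      using ex_countable_basis by blast
    have ne: "\<B> \<noteq> {}" using topological_basisE[OF \<B>(2) open_UNIV, of 0] by blast
    define V where "V = from_nat_into \<B>"
    have V_open: "open (V n)" for n
      unfolding V_def using topological_basis_open[OF \<B>(2)] from_nat_into[OF ne] by blast
    have V_basis: "\<exists>n. y \<in> V n \<and> V n \<subseteq> W" if "open W" "y \<in> W" for y W
      using topological_basisE[OF \<B>(2) that] from_nat_into_surj[OF \<B>(1)] unfolding V_def by metis
    have [measurable]: "V n \<in> sets borel" for n using V_open by simp
    note P[measurable]
    \<comment> \<open>\<open>C (Suc n)\<close> projects onto the points \<open>(x, y)\<close> for which \<open>V n\<close> does not witness that
      \<open>(x, y)\<close> avoids the closed section of \<open>P\<close> over \<open>x\<close>.\<close>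
    define C :: "nat \<Rightarrow> (('a \<times> real) \<times> real) set" where
      "C n = (case n of 0 \<Rightarrow> {p. fst p \<notin> P}
        | Suc n \<Rightarrow> {p. (fst (fst p), snd p) \<in> P \<and> snd p \<in> V n} \<union> {p. snd (fst p) \<notin> V n})" for n
    have C: "C n \<in> sets borel" for n
    proof -
      have [measurable]: "fst \<in> borel_measurable (borel :: (('a \<times> real) \<times> real) measure)"
        "snd \<in> borel_measurable (borel :: (('a \<times> real) \<times> real) measure)"
        "(\<lambda>p. snd (fst p)) \<in> borel_measurable (borel :: (('a \<times> real) \<times> real) measure)"
        "(\<lambda>p. (fst (fst p), snd p)) \<in> borel_measurable (borel :: (('a \<times> real) \<times> real) measure)"
        by (intro borel_measurable_continuous_onI continuous_intros)+
      have "{p \<in> space (borel :: (('a \<times> real) \<times> real) measure). fst p \<notin> P} \<in> sets borel"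
        "{p \<in> space (borel :: (('a \<times> real) \<times> real) measure). (fst (fst p), snd p) \<in> P \<and> snd p \<in> V n} \<in> sets borel"
        "{p \<in> space (borel :: (('a \<times> real) \<times> real) measure). snd (fst p) \<notin> V n} \<in> sets borel" for n
        by measurable
      then show ?thesis by (auto simp: C_def split: nat.split)
    qed
    have "(\<Inter>n. fst ` C n) = {}"
    proof (rule ccontr)
      assume "\<not> ?thesis"
      then obtain p where p: "p \<in> (\<Inter>n. fst ` C n)" unfolding ex_in_conv[symmetric] ..
      obtain x y where "p = (x, y)" by (cases p)
      with p have xy: "(x, y) \<in> fst ` C n" for n by (simp only: INT_iff UNIV_I)
      then have "(x, y) \<notin> P" using xy[of 0] by (auto simp: C_def)
      then obtain n where n: "y \<in> V n" "V n \<subseteq> - {y. (x, y) \<in> P}"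
        using V_basis[of "- {y. (x, y) \<in> P}" y] sec[of x] by auto
      then show False using xy[of "Suc n"] by (auto simp: C_def)
    qed
    then have "borel_separated (\<lambda>n. fst ` C n)"
      using C by (intro borel_separated_borel) (auto intro: continuous_on_fst continuous_on_id)
    then obtain B where B: "\<And>n. B n \<in> sets borel" "\<And>n. fst ` C n \<subseteq> B n" "(\<Inter>n. B n) = {}"
      unfolding borel_separated_def by blast
    \<comment> \<open>Over a point outside \<open>B (Suc n)\<close> the section of \<open>P\<close>
      misses \<open>V n\<close>. Hence the two projections are disjoint analytic sets, and a Borel
      set \<open>X\<close> separates them.\<close>
    have "\<exists>X. X \<in> sets borel \<and> X \<inter> fst ` (P \<inter> UNIV \<times> V n) = {} \<and>
        fst ` ((UNIV \<times> V n) \<inter> B 0 - B (Suc n)) \<subseteq> X" for n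
    proof -
      define K where "K m = (case m of 0 \<Rightarrow> (UNIV \<times> V n) \<inter> B 0 - B (Suc n)
        | Suc 0 \<Rightarrow> P \<inter> UNIV \<times> V n | _ \<Rightarrow> UNIV)" for m :: nat
      have UV: "UNIV \<times> V n \<in> sets (borel :: ('a \<times> real) measure)"
        using V_open by (simp add: open_Times)
      have K: "K m \<in> sets borel" for m
        unfolding K_def using B(1) P UV by (auto split: nat.split)
      have "(\<Inter>m. fst ` K m) = {}"
      proof (rule ccontr)
        assume "\<not> ?thesis"
        then obtain x where x: "\<And>m. x \<in> fst ` K m" by auto
        obtain y where y: "(x, y) \<notin> B (Suc n)" using x[of 0] by (auto simp: K_def)
        obtain y' where "(x, y') \<in> P" "y' \<in> V n" using x[of "Suc 0"] by (auto simp: K_def)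
        then have "((x, y), y') \<in> C (Suc n)" by (auto simp: C_def)
        then show False using B(2)[of "Suc n"] y by force
      qed
      then have "borel_separated (\<lambda>m. fst ` K m)"
        using K by (intro borel_separated_borel) (auto intro: continuous_on_fst continuous_on_id)
      then obtain X where X: "\<And>m. X m \<in> sets borel" "\<And>m. fst ` K m \<subseteq> X m" "(\<Inter>m. X m) = {}"
        unfolding borel_separated_def by blast
      define Y where "Y = X 0 \<inter> (\<Inter>m. X (Suc (Suc m)))"
      have "Y \<in> sets borel" unfolding Y_def using X(1) by auto
      moreover have "Y \<inter> fst ` (P \<inter> UNIV \<times> V n) = {}"
      proof (rule ccontr)
        assume "\<not> ?thesis"
        then obtain x where x: "x \<in> Y" "x \<in> fst ` K (Suc 0)" by (auto simp: K_def)
        then have "x \<in> X m" for m 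
          using X(2)[of "Suc 0"] by (cases m; cases "m - 1") (auto simp: Y_def)
        with X(3) show False by blast
      qed
      moreover have "fst ` ((UNIV \<times> V n) \<inter> B 0 - B (Suc n)) \<subseteq> Y"
        using X(2)[of 0] X(2)[of "Suc (Suc _)"] unfolding Y_def K_def by fastforce
      ultimately show ?thesis by blast
    qed
    then obtain X where X: "\<And>n. X n \<in> sets borel" "\<And>n. X n \<inter> fst ` (P \<inter> UNIV \<times> V n) = {}"
      "\<And>n. fst ` ((UNIV \<times> V n) \<inter> B 0 - B (Suc n)) \<subseteq> X n" by metis
    have cover: "\<exists>n. x \<in> X n \<and> y \<in> V n" if "(x, y) \<notin> P" for x y
    proof -
      have "((x, y), y) \<in> C 0" using that by (simp add: C_def)
      then have B0: "(x, y) \<in> B 0" using B(2)[of 0] by force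
      then obtain n where n: "(x, y) \<notin> B (Suc n)" using B(3) by (metis INT_I UNIV_I empty_iff not0_implies_Suc)
      then have "((x, y), y) \<notin> C (Suc n)" using B(2)[of "Suc n"] by force
      then have "y \<in> V n" by (simp add: C_def)
      with B0 n X(3)[of n] show ?thesis by force
    qed
    define \<F> where "\<F> = {F :: nat set. finite F \<and> {-N..N} \<subseteq> (\<Union>n\<in>F. V n)}"
    have "- (fst ` P) = (\<Union>F\<in>\<F>. \<Inter>n\<in>F. X n)"
    proof (intro equalityI subsetI)
      fix x assume "x \<in> - (fst ` P)"
      then have "\<And>y. (x, y) \<notin> P" by force
      then have "{-N..N} \<subseteq> (\<Union>n\<in>{n. x \<in> X n}. V n)" using cover by blast
      then obtain F where "F \<subseteq> {n. x \<in> X n}" "finite F" "{-N..N} \<subseteq> (\<Union>n\<in>F. V n)"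
        using compactE_image[OF compact_Icc, of "{n. x \<in> X n}" V "-N" N] V_open by metis
      then show "x \<in> (\<Union>F\<in>\<F>. \<Inter>n\<in>F. X n)" by (auto simp: \<F>_def)
    next
      fix x assume "x \<in> (\<Union>F\<in>\<F>. \<Inter>n\<in>F. X n)"
      then obtain F where F: "{-N..N} \<subseteq> (\<Union>n\<in>F. V n)" "\<And>n. n \<in> F \<Longrightarrow> x \<in> X n" by (auto simp: \<F>_def)
      show "x \<in> - (fst ` P)"
      proof
        assume "x \<in> fst ` P"
        then obtain y where y: "(x, y) \<in> P" by force
        then obtain n where "n \<in> F" "y \<in> V n" using PN F(1) by blast
        then show False using X(2)[of n] F(2) y by force
      qed
    qed
    moreover have "countable \<F>"
      by (rule countable_subset[OF _ countable_Collect_finite]) (auto simp: \<F>_def)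
    then have "(\<Union>F\<in>\<F>. \<Inter>n\<in>F. X n) \<in> sets borel"
    proof (rule sets.countable_UN'')
      fix F assume "F \<in> \<F>"
      then show "(\<Inter>n\<in>F. X n) \<in> sets borel"
        using X(1) by (cases "F = {}") (auto simp: \<F>_def intro!: sets.finite_INT)
    qed
    ultimately have "- (fst ` P) \<in> sets borel" by simp
    from borel_comp[OF this] show ?thesis by simp
  qed
  have eq: "fst ` P = (\<Union>N::nat. fst ` (P \<inter> UNIV \<times> {- real N..real N}))"
  proof (intro equalityI subsetI)
    fix x assume "x \<in> fst ` P"
    then obtain y where y: "(x, y) \<in> P" by force
    obtain N :: nat where "\<bar>y\<bar> \<le> real N" using real_arch_simple by blast
    then have "(x, y) \<in> P \<inter> UNIV \<times> {- real N..real N}" using y by auto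
    then show "x \<in> (\<Union>N::nat. fst ` (P \<inter> UNIV \<times> {- real N..real N}))" by force
  qed auto
  have "fst ` (P \<inter> UNIV \<times> {- real N..real N}) \<in> sets borel" for N
  proof (rule bounded[of _ "real N"])
    show "P \<inter> UNIV \<times> {- real N..real N} \<in> sets borel"
      by (intro sets.Int P borel_closed closed_Times) auto
    have "{y. (x, y) \<in> P \<inter> UNIV \<times> {- real N..real N}} = {y. (x, y) \<in> P} \<inter> {- real N..real N}" for x
      by auto
    then show "closed {y. (x, y) \<in> P \<inter> UNIV \<times> {- real N..real N}}" for x
      using sec by auto
  qed auto
  then show ?thesis unfolding eq by auto
qed

section \<open>Finite sections in standard Borel spaces\<close>

lemma suminf_ternary:
  fixes z :: "nat \<Rightarrow> nat"
  assumes z: "\<And>n. z n \<le> 1"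
  defines "r \<equiv> (\<Sum>n. real (z n) / 3 ^ Suc n)"
  shows "\<lfloor>3 ^ Suc n * r\<rfloor> mod 3 = int (z n)"
proof -
  have geo: "summable (\<lambda>n. 1 / 3 ^ Suc n :: real)" "(\<Sum>n. 1 / 3 ^ Suc n :: real) = 1 / 2"
    using sums_mult[OF geometric_sums[of "1/3 :: real"], of "1/3"]
    by (auto simp: sums_iff power_one_over field_simps)
  have sm: "summable (\<lambda>n. real (z (n + k)) / 3 ^ Suc n)" for k
    by (rule summable_comparison_test'[OF geo(1), of 0]) (use z in \<open>auto simp: divide_right_mono\<close>)
  \<comment> \<open>The scaled tail after place \<open>n\<close>. Since the digits are 0 or 1 it is
    at most 1/2, so it never carries into place \<open>n\<close>; in base 2 it could reach
    1.\<close>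
  define t where "t = (\<Sum>i. real (z (i + Suc n)) / 3 ^ Suc i)"
  have t: "0 \<le> t" "t < 1"
  proof -
    show "0 \<le> t" unfolding t_def by (intro suminf_nonneg sm) auto
    have "t \<le> 1/2" unfolding t_def geo(2)[symmetric]
      using sm[of "Suc n"] geo(1) by (intro suminf_le) (use z in \<open>auto simp: divide_right_mono\<close>)
    then show "t < 1" by simp
  qed
  have "r = (\<Sum>i. real (z (i + Suc n)) / 3 ^ Suc (i + Suc n)) + (\<Sum>i<Suc n. real (z i) / 3 ^ Suc i)"
    unfolding r_def using sm[of 0] by (intro suminf_split_initial_segment) simp
  also have "(\<Sum>i. real (z (i + Suc n)) / 3 ^ Suc (i + Suc n)) = t / 3 ^ Suc n"
    unfolding t_def using suminf_divide[OF sm[of "Suc n"], of "3 ^ Suc n"]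
    by (simp add: power_add field_simps)
  finally have r: "3 ^ Suc n * r = t + (\<Sum>i<Suc n. real (z i) * 3 ^ (n - i))"
  proof -
    assume r: "r = t / 3 ^ Suc n + (\<Sum>i<Suc n. real (z i) / 3 ^ Suc i)"
    have "3 ^ Suc n * (real (z i) / 3 ^ Suc i) = real (z i) * 3 ^ (n - i)" if "i < Suc n" for i
    proof -
      have "(3::real) ^ Suc n = 3 ^ Suc i * 3 ^ (n - i)"
        using that by (simp flip: power_add)
      then show ?thesis by simp
    qed
    then have "(\<Sum>i<Suc n. 3 ^ Suc n * (real (z i) / 3 ^ Suc i)) = (\<Sum>i<Suc n. real (z i) * 3 ^ (n - i))"
      by (intro sum.cong) auto
    then show ?thesis unfolding r distrib_left sum_distrib_left by simp
  qed
  define N :: int where "N = (\<Sum>i<n. int (z i) * 3 ^ (n - i))"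
  have "(\<Sum>i<Suc n. real (z i) * 3 ^ (n - i)) = of_int (N + int (z n))"
    by (simp add: N_def)
  with r t have "\<lfloor>3 ^ Suc n * r\<rfloor> = N + int (z n)"
    by (intro floor_unique) auto
  moreover have "3 dvd N" unfolding N_def
    by (intro dvd_sum dvd_mult) (auto intro: dvd_power)
  then obtain m where "N = 3 * m" by (rule dvdE)
  moreover have "z n = 0 \<or> z n = 1" using z[of n] by linarith
  ultimately show ?thesis by auto
qed

text \<open>The code of \<open>x\<close> lists, as ternary digits, which points \<open>q i\<close>
  of a dense sequence are within which distance \<open>e k\<close> of \<open>x\<close>. The range is
  Borel because a real number can be decoded to a sequence, tested for the Cauchy property, and
  compared with the code of the limit. The image of an open set is then a countable condition on the
  digits.\<close>

lemma standard_borel_real_embedding: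
  fixes M :: "'a measure"
  assumes "standard_borel M"
  obtains \<phi> :: "'a \<Rightarrow> real" where "\<phi> \<in> borel_measurable M" "inj_on \<phi> (space M)"
    "\<And>B. B \<in> sets M \<Longrightarrow> \<phi> ` B \<in> sets borel"
proof -
  from assms obtain T where T: "completely_metrizable_space T" "separable_space T" "topspace T = space M"
      "sets M = sigma_sets (space M) {U. openin T U}"
    unfolding standard_borel_def by blast
  from T(1) obtain X d where X: "Metric_space X d" "Metric_space.mcomplete X d" "T = Metric_space.mtopology X d"
    unfolding completely_metrizable_space_def by blast
  interpret Metric_space X d by fact
  have XM: "X = space M" using T(3) X(3) by simp
  show ?thesis
  proof (cases "X = {}")
    case True
    then have "space M = {}" using XM by simp
    moreover from this have "B = {}" if "B \<in> sets M" for B using sets.sets_into_space[OF that] by simp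
    ultimately show ?thesis by (intro that[of "\<lambda>_. 0"]) (auto simp: inj_on_def image_constant_conv)
  next
    case False
    from T(2) obtain Q where Q: "countable Q" "Q \<subseteq> X" "T closure_of Q = X"
      unfolding separable_space_def using T(3) XM by auto
    have "Q \<noteq> {}" using Q(3) False by auto
    define q where "q = from_nat_into Q"
    have qX: "q i \<in> X" for i using from_nat_into[OF \<open>Q \<noteq> {}\<close>] Q(2) by (auto simp: q_def)
    have dense: "\<exists>i. d x (q i) < e" if "x \<in> X" "e > 0" for x e
    proof -
      have "x \<in> T closure_of Q" using Q(3) that by simp
      then have "\<exists>y\<in>Q. y \<in> mball x e"
        using \<open>e > 0\<close> unfolding X(3) metric_closure_of by blast
      then obtain y where "y \<in> Q" "y \<in> mball x e" by blast
      then show ?thesis using from_nat_into_surj[OF Q(1), of y] by (auto simp: q_def)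
    qed
    define e where "e k = 1 / real (Suc k)" for k
    have e: "e k > 0" for k by (simp add: e_def)
    define z where "z x n = (if d x (q (snd (prod_decode n))) < e (fst (prod_decode n)) then 1 else 0 :: nat)" for x n
    define \<phi> where "\<phi> x = (\<Sum>n. real (z x n) / 3 ^ Suc n)" for x
    define digit where "digit n r = \<lfloor>3 ^ Suc n * r\<rfloor> mod 3" for n and r :: real
    have digit: "digit n (\<phi> x) = int (z x n)" for n x
      unfolding digit_def \<phi>_def by (rule suminf_ternary) (simp add: z_def)
    have digit1: "digit (prod_encode (k, i)) (\<phi> x) = 1 \<longleftrightarrow> d x (q i) < e k" for k i x
      unfolding digit by (simp add: z_def)
    have open_M: "U \<in> sets M" if "openin T U" for U using that T(4) by auto
    have [measurable]: "Measurable.pred M (\<lambda>x. d x (q i) < r)" for i r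
    proof -
      have "{x \<in> space M. d x (q i) < r} = mball (q i) r"
        using qX by (auto simp: XM[symmetric] commute)
      then show ?thesis using open_M[of "mball (q i) r"] X(3) by (simp add: pred_def)
    qed
    have \<phi>_meas: "\<phi> \<in> borel_measurable M"
      unfolding \<phi>_def z_def by measurable
    have \<phi>_inj: "inj_on \<phi> (space M)"
    proof (rule inj_onI, rule ccontr)
      fix x y assume xy: "x \<in> space M" "y \<in> space M" "\<phi> x = \<phi> y" "x \<noteq> y"
      then have "d x y > 0" using XM by auto
      then obtain k where k: "e k < d x y / 2" using nat_approx_posE[of "d x y / 2"] by (auto simp: e_def)
      obtain i where i: "d x (q i) < e k" using dense[of x "e k"] e xy XM by auto
      then have "d y (q i) < e k" using digit1 xy(3) by metis
      then show False using triangle[of x "q i" y] i k xy XM qX by (simp add: commute)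
    qed
    \<comment> \<open>The first dense point that the digits of \<open>r\<close> place within
      \<open>e k\<close> of the coded point. If \<open>r\<close> is not a code the sequence is
      arbitrary and is left to the tests below.\<close>
    define a where "a r k = q (LEAST i. digit (prod_encode (k, i)) r = 1)" for r k
    have [measurable]: "(\<lambda>r. digit n r) \<in> borel \<rightarrow>\<^sub>M count_space UNIV" for n
    proof -
      have "(\<lambda>r :: real. \<lfloor>3 ^ Suc n * r\<rfloor>) \<in> borel \<rightarrow>\<^sub>M count_space UNIV" by measurable
      from measurable_compose[OF this, of "\<lambda>i. i mod 3" "count_space UNIV"] show ?thesis
        by (simp add: digit_def)
    qed
    have [measurable]: "(\<lambda>r. LEAST i. digit (prod_encode (k, i)) r = 1) \<in> borel \<rightarrow>\<^sub>M count_space UNIV" for k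
      by measurable
    have [measurable]: "(\<lambda>r. d (a r k) (q i)) \<in> borel_measurable borel" for k i
      unfolding a_def by (rule measurable_compose_countable[of "\<lambda>j r. d (q j) (q i)"]) measurable
    have d_a[measurable]: "(\<lambda>r. d (a r k) (a r l)) \<in> borel_measurable borel" for k l
      unfolding a_def[of _ l] by (rule measurable_compose_countable[of "\<lambda>j r. d (a r k) (q j)"]) measurable
    \<comment> \<open>The code of the limit of \<open>a r\<close>, with the distances from the limit
      point written as limits of real numbers. This is Borel in \<open>r\<close> without reference
      to the limit point.\<close>
    define \<Psi> where "\<Psi> r = (\<Sum>n. real (if lim (\<lambda>k. d (a r k) (q (snd (prod_decode n)))) < e (fst (prod_decode n)) then 1 else 0 :: nat) / 3 ^ Suc n)" for r
    have [measurable]: "\<Psi> \<in> borel_measurable borel" unfolding \<Psi>_def by measurable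
    define cauchy where "cauchy r \<longleftrightarrow> (\<forall>m. \<exists>N. \<forall>k\<ge>N. \<forall>l\<ge>N. d (a r k) (a r l) < e m)" for r
    have cauchy: "cauchy r \<longleftrightarrow> MCauchy (a r)" for r
    proof
      assume c: "cauchy r"
      show "MCauchy (a r)" unfolding MCauchy_def
      proof (intro conjI allI impI)
        show "range (a r) \<subseteq> X" using qX by (auto simp: a_def)
        fix \<epsilon> :: real assume "\<epsilon> > 0"
        then obtain m where m: "e m < \<epsilon>" using nat_approx_posE unfolding e_def by metis
        from c obtain N where "\<And>k l. k \<ge> N \<Longrightarrow> l \<ge> N \<Longrightarrow> d (a r k) (a r l) < e m" unfolding cauchy_def by blast
        with m show "\<exists>N. \<forall>n n'. N \<le> n \<longrightarrow> N \<le> n' \<longrightarrow> d (a r n) (a r n') < \<epsilon>" by (meson less_trans)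
      qed
    next
      assume "MCauchy (a r)"
      then show "cauchy r" unfolding MCauchy_def cauchy_def using e by meson
    qed
    have lim_d: "lim (\<lambda>k. d (a r k) (q i)) = d x (q i)" if "limitin T (a r) x sequentially" for r x i
    proof (rule limI)
      have x: "x \<in> X" using that limitin_topspace X(3) by fastforce
      have aX: "a r k \<in> X" for k using qX by (simp add: a_def)
      have "(\<lambda>k. d (a r k) x) \<longlonglongrightarrow> 0" using that unfolding X(3) limitin_metric_dist_null by simp
      moreover have "\<bar>d (a r k) (q i) - d x (q i)\<bar> \<le> d (a r k) x" for k
        using mdist_reverse_triangle[of "a r k" "q i" x] aX x qX by (simp add: commute abs_minus_commute)
      ultimately have "(\<lambda>k. d (a r k) (q i) - d x (q i)) \<longlonglongrightarrow> 0"
        by (rule_tac Lim_null_comparison) (auto intro!: always_eventually)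
      then show "(\<lambda>k. d (a r k) (q i)) \<longlonglongrightarrow> d x (q i)" by (simp add: LIM_zero_iff)
    qed
    have \<Psi>: "\<Psi> r = \<phi> x" if "limitin T (a r) x sequentially" for r x
      unfolding \<Psi>_def lim_d[OF that] \<phi>_def z_def ..
    have range_eq: "\<phi> ` space M = {r. cauchy r \<and> \<Psi> r = r}"
    proof (intro equalityI subsetI)
      fix r assume "r \<in> \<phi> ` space M"
      then obtain x where x: "x \<in> X" "r = \<phi> x" using XM by auto
      have a: "d (a r k) x < e k" for k
      proof -
        obtain i where "d x (q i) < e k" using dense[OF x(1) e] by blast
        then have "digit (prod_encode (k, i)) r = 1" using digit1 x(2) by simp
        then have "digit (prod_encode (k, LEAST i. digit (prod_encode (k, i)) r = 1)) r = 1" by (rule LeastI)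
        then show ?thesis using digit1 x(2) by (simp add: a_def commute)
      qed
      have "limitin T (a r) x sequentially"
        unfolding X(3) limitin_metric_dist_null
      proof (intro conjI x)
        show "\<forall>\<^sub>F k in sequentially. a r k \<in> X" using qX by (simp add: a_def)
        have "e \<longlonglongrightarrow> 0" unfolding e_def using LIMSEQ_inverse_real_of_nat by (simp add: inverse_eq_divide)
        then show "(\<lambda>k. d (a r k) x) \<longlonglongrightarrow> 0"
          by (rule Lim_null_comparison[rotated]) (use a in \<open>auto intro!: always_eventually less_imp_le\<close>)
      qed
      then have "cauchy r" "\<Psi> r = r"
        using \<Psi> x(2) cauchy convergent_imp_MCauchy[of "a r" x] qX X(3) by (auto simp: a_def)
      then show "r \<in> {r. cauchy r \<and> \<Psi> r = r}" by simp
    next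
      fix r assume r: "r \<in> {r. cauchy r \<and> \<Psi> r = r}"
      then obtain x where x: "limitin T (a r) x sequentially"
        using X(2,3) cauchy unfolding mcomplete_def by auto
      then have "x \<in> space M" using limitin_topspace T(3) by fastforce
      then show "r \<in> \<phi> ` space M" using \<Psi>[OF x] r by auto
    qed
    have "Measurable.pred borel (\<lambda>r. cauchy r \<and> \<Psi> r = r)"
      unfolding cauchy_def by measurable
    then have range_borel: "\<phi> ` space M \<in> sets borel" unfolding range_eq by (simp add: pred_def)
    have "\<phi> ` B \<in> sets borel" if "B \<in> sigma_sets (space M) {U. openin T U}" for B
      using that
    proof induction
      case (Basic U)
      then have U: "openin T U" by simp
      define I where "I = {n. mball (q (snd (prod_decode n))) (e (fst (prod_decode n))) \<subseteq> U}"
      have "\<phi> ` U = \<phi> ` space M \<inter> (\<Union>n\<in>I. {r. digit n r = 1})"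
      proof (intro equalityI subsetI)
        fix r assume "r \<in> \<phi> ` U"
        then obtain x where x: "x \<in> U" "r = \<phi> x" by auto
        have xX: "x \<in> X" using x(1) U openin_subset T(3) XM by blast
        obtain \<epsilon> where \<epsilon>: "\<epsilon> > 0" "mball x \<epsilon> \<subseteq> U" using U x(1) unfolding X(3) openin_mtopology by blast
        then obtain k where k: "e k < \<epsilon> / 2" using nat_approx_posE[of "\<epsilon> / 2"] by (auto simp: e_def)
        obtain i where i: "d x (q i) < e k" using dense[OF xX e] by blast
        have "mball (q i) (e k) \<subseteq> mball x \<epsilon>"
        proof
          fix y assume "y \<in> mball (q i) (e k)"
          then show "y \<in> mball x \<epsilon>" using triangle[of x "q i" y] i k xX qX by auto
        qed
        then have "prod_encode (k, i) \<in> I" using \<epsilon>(2) by (auto simp: I_def)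
        moreover have "digit (prod_encode (k, i)) r = 1" using i x(2) digit1 by simp
        ultimately show "r \<in> \<phi> ` space M \<inter> (\<Union>n\<in>I. {r. digit n r = 1})" using x xX XM by auto
      next
        fix r assume "r \<in> \<phi> ` space M \<inter> (\<Union>n\<in>I. {r. digit n r = 1})"
        then obtain x n where x: "x \<in> X" "r = \<phi> x" "n \<in> I" "digit n r = 1" using XM by auto
        then have "d x (q (snd (prod_decode n))) < e (fst (prod_decode n))"
          using digit1[of "fst (prod_decode n)" "snd (prod_decode n)" x] by simp
        then have "x \<in> U" using x qX by (auto simp: I_def commute)
        then show "r \<in> \<phi> ` U" using x by auto
      qed
      moreover have "{r. digit n r = 1} \<in> sets borel" for n
      proof -
        have "Measurable.pred borel (\<lambda>r. digit n r = 1)" by measurable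
        then show ?thesis by (simp add: pred_def)
      qed
      ultimately show ?case using range_borel by auto
    next
      case (Compl B)
      then have "B \<subseteq> space M" using T(4) sets.sets_into_space by metis
      then have "\<phi> ` (space M - B) = \<phi> ` space M - \<phi> ` B" using \<phi>_inj by (intro inj_on_image_set_diff) auto
      then show ?case using Compl range_borel by auto
    qed (auto simp: image_UN)
    with \<phi>_meas \<phi>_inj T(4) show ?thesis by (intro that) auto
  qed
qed

text \<open>The code carries \<open>S\<close> to a Borel subset of the plane whose sections are
  finite, hence closed. Its projection is Borel and pulls back to that of \<open>S\<close>.\<close>

lemma sets_fst_image_finite_sections:
  fixes M :: "'a measure"
  assumes M: "standard_borel M" and S: "S \<in> sets (M \<Otimes>\<^sub>M M)"
    and fin: "\<And>x. x \<in> space M \<Longrightarrow> finite {y. (x, y) \<in> S}"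
  shows "fst ` S \<in> sets M"
proof -
  obtain \<phi> :: "'a \<Rightarrow> real" where \<phi>: "\<phi> \<in> borel_measurable M" "inj_on \<phi> (space M)"
    "\<And>B. B \<in> sets M \<Longrightarrow> \<phi> ` B \<in> sets borel"
    using standard_borel_real_embedding[OF M] by blast
  have inj: "inj_on (map_prod \<phi> \<phi>) (space M \<times> space M)"
    using \<phi>(2) by (intro map_prod_inj_on)
  have sub: "S \<subseteq> space M \<times> space M" using sets.sets_into_space[OF S] by (simp add: space_pair_measure)
  have "map_prod \<phi> \<phi> ` A \<in> sets borel" if "A \<in> sets (M \<Otimes>\<^sub>M M)" for A
    using that unfolding sets_pair_measure
  proof induction
    case (Basic A)
    then obtain a b where ab: "A = a \<times> b" "a \<in> sets M" "b \<in> sets M" by auto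
    have "map_prod \<phi> \<phi> ` A = \<phi> ` a \<times> \<phi> ` b" unfolding ab(1) by force
    then show ?case using ab \<phi>(3) by (simp add: borel_Times)
  next
    case (Compl A)
    then have "A \<in> sets (M \<Otimes>\<^sub>M M)" by (simp add: sets_pair_measure)
    then have "A \<subseteq> space M \<times> space M" using sets.sets_into_space by (metis space_pair_measure)
    then have "map_prod \<phi> \<phi> ` (space M \<times> space M - A) = map_prod \<phi> \<phi> ` (space M \<times> space M) - map_prod \<phi> \<phi> ` A"
      using inj by (intro inj_on_image_set_diff) auto
    moreover have "map_prod \<phi> \<phi> ` (space M \<times> space M) = \<phi> ` space M \<times> \<phi> ` space M" by force
    ultimately show ?case using Compl \<phi>(3)[OF sets.top] by (simp add: borel_Times sets.Diff)
  qed (auto simp: image_UN)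
  from this[OF S] have "fst ` map_prod \<phi> \<phi> ` S \<in> sets borel"
  proof (rule borel_fst_image_closed_sections)
    fix r
    show "closed {s. (r, s) \<in> map_prod \<phi> \<phi> ` S}"
    proof (cases "r \<in> \<phi> ` space M")
      case True
      then obtain x where x: "x \<in> space M" "r = \<phi> x" by auto
      then have "{s. (r, s) \<in> map_prod \<phi> \<phi> ` S} \<subseteq> \<phi> ` {y. (x, y) \<in> S}"
        using \<phi>(2) sub by (fastforce dest: inj_onD)
      then show ?thesis using fin[OF x(1)] by (meson finite_imageI finite_imp_closed finite_subset)
    next
      case False
      then have "{s. (r, s) \<in> map_prod \<phi> \<phi> ` S} = {}" using sub by auto
      then show ?thesis by (metis closed_empty)
    qed
  qed
  then have "\<phi> -` (fst ` map_prod \<phi> \<phi> ` S) \<inter> space M \<in> sets M"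
    by (rule measurable_sets[OF \<phi>(1)])
  also have "\<phi> -` (fst ` map_prod \<phi> \<phi> ` S) \<inter> space M = fst ` S"
  proof (intro equalityI subsetI)
    fix x assume "x \<in> \<phi> -` (fst ` map_prod \<phi> \<phi> ` S) \<inter> space M"
    then obtain x' y where xy: "x \<in> space M" "(x', y) \<in> S" "\<phi> x = \<phi> x'" by auto
    then have "x = x'" using \<phi>(2) sub by (auto dest: inj_onD)
    with xy show "x \<in> fst ` S" by force
  next
    fix x assume "x \<in> fst ` S"
    then show "x \<in> \<phi> -` (fst ` map_prod \<phi> \<phi> ` S) \<inter> space M" using sub by force
  qed
  finally show ?thesis .
qed

section \<open>Enumerating finite sections by Borel functions\<close>

lemma measurable_via_embedding:
  assumes \<phi>: "\<phi> \<in> borel_measurable M" "inj_on \<phi> (space M)" "\<And>B. B \<in> sets M \<Longrightarrow> \<phi> ` B \<in> sets borel"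
    and f: "f \<in> space M \<rightarrow> space M" "(\<lambda>x. \<phi> (f x)) \<in> borel_measurable M"
  shows "f \<in> M \<rightarrow>\<^sub>M M"
proof (rule measurableI)
  fix B assume B: "B \<in> sets M"
  have "f -` B \<inter> space M = (\<lambda>x. \<phi> (f x)) -` (\<phi> ` B) \<inter> space M"
    using f(1) \<phi>(2) sets.sets_into_space[OF B] by (fastforce dest: inj_onD)
  also have "\<dots> \<in> sets M" using f(2) \<phi>(3)[OF B] by (rule measurable_sets)
  finally show "f -` B \<inter> space M \<in> sets M" .
qed (use f(1) in auto)

text \<open>The functions pick the points of the finite section whose code is the least one above a given
  rational number.\<close>

lemma finite_sections_enumeration:
  fixes M :: "'a measure"
  assumes M: "standard_borel M" and \<Gamma>: "\<Gamma> \<in> sets (M \<Otimes>\<^sub>M M)"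
    and fin: "\<And>x. x \<in> space M \<Longrightarrow> finite {y. (x, y) \<in> \<Gamma>}"
  obtains f :: "nat \<Rightarrow> 'a \<Rightarrow> 'a" where "\<And>i. f i \<in> M \<rightarrow>\<^sub>M M"
    "\<And>x. x \<in> space M \<Longrightarrow> (\<lambda>i. f i x) ` UNIV = insert x {y. (x, y) \<in> \<Gamma>}"
proof -
  obtain \<phi> :: "'a \<Rightarrow> real" where \<phi>: "\<phi> \<in> borel_measurable M" "inj_on \<phi> (space M)"
    "\<And>B. B \<in> sets M \<Longrightarrow> \<phi> ` B \<in> sets borel"
    using standard_borel_real_embedding[OF M] by blast
  note \<phi>(1)[measurable]
  have sub: "\<Gamma> \<subseteq> space M \<times> space M" using sets.sets_into_space[OF \<Gamma>] by (simp add: space_pair_measure)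
  define up where "up a x = {y. (x, y) \<in> \<Gamma> \<and> a < \<phi> y}" for a x
  have up: "finite (up a x)" if "x \<in> space M" for a x
    using fin[OF that] by (rule rev_finite_subset) (auto simp: up_def)
  \<comment> \<open>If no point of the section has a code above \<open>a\<close>, the default is
    \<open>x\<close>, which the conclusion admits through \<open>insert x\<close>.\<close>
  define g where "g a x = (if up a x = {} then x else inv_into (space M) \<phi> (Min (\<phi> ` up a x)))" for a x
  have g_min: "g a x \<in> up a x" "\<phi> (g a x) = Min (\<phi> ` up a x)" if "x \<in> space M" "up a x \<noteq> {}" for a x
  proof -
    have "Min (\<phi> ` up a x) \<in> \<phi> ` up a x" using up that by simp
    then obtain y where y: "y \<in> up a x" "Min (\<phi> ` up a x) = \<phi> y" by auto
    then have "y \<in> space M" using sub by (auto simp: up_def)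
    then have "g a x = y" using that y \<phi>(2) by (simp add: g_def)
    then show "g a x \<in> up a x" "\<phi> (g a x) = Min (\<phi> ` up a x)" using y by auto
  qed
  have g_mem: "g a x \<in> insert x {y. (x, y) \<in> \<Gamma>}" if "x \<in> space M" for a x
  proof (cases "up a x = {}")
    case True
    then show ?thesis by (simp add: g_def)
  next
    case False
    from g_min(1)[OF that this] show ?thesis unfolding up_def[of a x] by simp
  qed
  have proj: "{x \<in> space M. \<exists>y. (x, y) \<in> \<Gamma> \<and> P (\<phi> y)} \<in> sets M" if [measurable]: "Measurable.pred borel P" for P
  proof -
    note \<Gamma>[measurable]
    have "{p \<in> space (M \<Otimes>\<^sub>M M). p \<in> \<Gamma> \<and> P (\<phi> (snd p))} \<in> sets (M \<Otimes>\<^sub>M M)"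
      by measurable
    then have "fst ` {p \<in> space (M \<Otimes>\<^sub>M M). p \<in> \<Gamma> \<and> P (\<phi> (snd p))} \<in> sets M"
    proof (rule sets_fst_image_finite_sections[OF M])
      show "finite {y. (x, y) \<in> {p \<in> space (M \<Otimes>\<^sub>M M). p \<in> \<Gamma> \<and> P (\<phi> (snd p))}}" if "x \<in> space M" for x
        using fin[OF that] by (rule rev_finite_subset) auto
    qed
    also have "fst ` {p \<in> space (M \<Otimes>\<^sub>M M). p \<in> \<Gamma> \<and> P (\<phi> (snd p))} = {x \<in> space M. \<exists>y. (x, y) \<in> \<Gamma> \<and> P (\<phi> y)}"
      using sub by (force simp: space_pair_measure)
    finally show ?thesis .
  qed
  have "g a \<in> M \<rightarrow>\<^sub>M M" for a
  proof (rule measurable_via_embedding[OF \<phi>])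
    show "g a \<in> space M \<rightarrow> space M"
    proof
      fix x assume x: "x \<in> space M"
      from g_mem[OF this, of a] this sub show "g a x \<in> space M" by (metis SigmaD2 insertE mem_Collect_eq subsetD)
    qed
    show "(\<lambda>x. \<phi> (g a x)) \<in> borel_measurable M"
      unfolding borel_measurable_iff_less
    proof
      fix r
      have "{x \<in> space M. \<phi> (g a x) < r} = {x \<in> space M. \<exists>y. (x, y) \<in> \<Gamma> \<and> a < \<phi> y \<and> \<phi> y < r} \<union>
        ({x \<in> space M. \<phi> x < r} - {x \<in> space M. \<exists>y. (x, y) \<in> \<Gamma> \<and> a < \<phi> y})"
      proof -
        have "\<phi> (g a x) < r \<longleftrightarrow> (\<exists>y. (x, y) \<in> \<Gamma> \<and> a < \<phi> y \<and> \<phi> y < r)" if "x \<in> space M" "up a x \<noteq> {}" for x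
          using g_min[OF that] up[OF that(1), of a] that(2) by (auto simp: Min_less_iff up_def)
        moreover have "g a x = x" if "up a x = {}" for x using that by (simp add: g_def)
        ultimately show ?thesis by (auto simp: up_def) (metis (no_types, lifting))+
      qed
      also have "\<dots> \<in> sets M"
        by (intro sets.Un sets.Diff proj) measurable
      finally show "{x \<in> space M. \<phi> (g a x) < r} \<in> sets M" .
    qed
  qed
  define f where "f n = (case n of 0 \<Rightarrow> (\<lambda>x. x) | Suc i \<Rightarrow> g (real_of_rat (from_nat i)))" for n
  have "f i \<in> M \<rightarrow>\<^sub>M M" for i
    using \<open>\<And>a. g a \<in> M \<rightarrow>\<^sub>M M\<close> by (auto simp: f_def split: nat.split)
  moreover have "(\<lambda>i. f i x) ` UNIV = insert x {y. (x, y) \<in> \<Gamma>}" if x: "x \<in> space M" for x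
  proof (intro equalityI subsetI)
    fix y assume "y \<in> (\<lambda>i. f i x) ` UNIV"
    then obtain i where "y = f i x" by blast
    then show "y \<in> insert x {y. (x, y) \<in> \<Gamma>}"
      using g_mem[OF x, of "real_of_rat (from_nat (i - 1))"] by (cases i) (simp_all add: f_def)
  next
    fix y assume "y \<in> insert x {y. (x, y) \<in> \<Gamma>}"
    then consider "y = x" | "(x, y) \<in> \<Gamma>" by auto
    then show "y \<in> (\<lambda>i. f i x) ` UNIV"
    proof cases
      case 1
      then have "y = f 0 x" by (simp add: f_def)
      then show ?thesis by blast
    next
      case 2
      \<comment> \<open>A rational number between the largest element of \<open>L\<close> and
        \<open>\<phi> y\<close> makes \<open>y\<close> the point of least code above it. The element
        \<open>\<phi> y - 1\<close> only keeps \<open>L\<close> nonempty.\<close>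
      define L where "L = insert (\<phi> y - 1) {r \<in> \<phi> ` {y. (x, y) \<in> \<Gamma>}. r < \<phi> y}"
      have L: "finite L" "L \<noteq> {}" using fin[OF x] by (auto simp: L_def)
      then have "Max L < \<phi> y" using Max_in[OF L] by (auto simp: L_def)
      then obtain a where a: "Max L < real_of_rat a" "real_of_rat a < \<phi> y" using of_rat_dense by blast
      have "y \<in> up (real_of_rat a) x" using 2 a by (simp add: up_def)
      moreover have "\<phi> y \<le> \<phi> y'" if "y' \<in> up (real_of_rat a) x" for y'
      proof (rule ccontr)
        assume "\<not> ?thesis"
        then have "\<phi> y' \<in> L" using that by (auto simp: L_def up_def)
        then have "\<phi> y' \<le> Max L" using L by simp
        then show False using a that by (simp add: up_def)
      qed
      ultimately have "Min (\<phi> ` up (real_of_rat a) x) = \<phi> y" "up (real_of_rat a) x \<noteq> {}"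
        using up[OF x] by (auto intro!: Min_eqI)
      then have "\<phi> (g (real_of_rat a) x) = \<phi> y" "g (real_of_rat a) x \<in> up (real_of_rat a) x"
        using g_min[OF x, of "real_of_rat a"] by simp_all
      then have "g (real_of_rat a) x = y" using \<phi>(2) 2 sub by (auto simp: up_def dest: inj_onD)
      then have "f (Suc (to_nat a)) x = y" by (simp add: f_def)
      then show ?thesis by blast
    qed
  qed
  ultimately show ?thesis using that by blast
qed

section \<open>Separated finite pieces from coarse scales\<close>

definition gball :: "('a \<times> 'a) set \<Rightarrow> 'a \<Rightarrow> nat \<Rightarrow> 'a set" where
  "gball \<Gamma> x r = {y. \<exists>n\<le>r. (x, y) \<in> \<Gamma> ^^ n}"

lemma gball_self [simp]: "x \<in> gball \<Gamma> x r"
  by (auto simp: gball_def intro: exI[of _ 0])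

lemma gball_mono: "r \<le> s \<Longrightarrow> gball \<Gamma> x r \<subseteq> gball \<Gamma> x s"
  by (auto simp: gball_def intro: le_trans)

lemma gball_trans: "y \<in> gball \<Gamma> x r \<Longrightarrow> z \<in> gball \<Gamma> y s \<Longrightarrow> z \<in> gball \<Gamma> x (r + s)"
proof -
  assume "y \<in> gball \<Gamma> x r" "z \<in> gball \<Gamma> y s"
  then obtain m n where mn: "m \<le> r" "n \<le> s" "(x, y) \<in> \<Gamma> ^^ m" "(y, z) \<in> \<Gamma> ^^ n" by (auto simp: gball_def)
  then have "(x, z) \<in> \<Gamma> ^^ (m + n)" unfolding relpow_add by blast
  then show ?thesis using mn(1,2) add_mono unfolding gball_def by blast
qed

lemma gball_subset: "y \<in> gball \<Gamma> x r \<Longrightarrow> r + s \<le> t \<Longrightarrow> gball \<Gamma> y s \<subseteq> gball \<Gamma> x t"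
proof
  fix z assume "y \<in> gball \<Gamma> x r" "r + s \<le> t" "z \<in> gball \<Gamma> y s"
  then show "z \<in> gball \<Gamma> x t" using gball_trans[of y \<Gamma> x r z s] gball_mono[of "r + s" t \<Gamma> x] by (simp add: subset_iff)
qed

lemma gball_1: "gball \<Gamma> x (Suc 0) = insert x {y. (x, y) \<in> \<Gamma>}"
  by (auto simp: gball_def le_Suc_eq)

lemma gball_Suc: "gball \<Gamma> x (Suc r) = (\<Union>y\<in>gball \<Gamma> x 1. gball \<Gamma> y r)"
proof (intro equalityI subsetI)
  fix z assume "z \<in> gball \<Gamma> x (Suc r)"
  then obtain n where n: "n \<le> Suc r" "(x, z) \<in> \<Gamma> ^^ n" by (auto simp: gball_def)
  show "z \<in> (\<Union>y\<in>gball \<Gamma> x 1. gball \<Gamma> y r)"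
  proof (cases n)
    case 0
    then show ?thesis using n by (intro UN_I[of x]) auto
  next
    case (Suc k)
    then obtain y where "(x, y) \<in> \<Gamma>" "(y, z) \<in> \<Gamma> ^^ k" using n(2) by (metis relpow_Suc_E2)
    then show ?thesis using Suc n(1) by (intro UN_I[of y]) (auto simp: gball_def intro: exI[of _ 1] exI[of _ k])
  qed
next
  fix z assume "z \<in> (\<Union>y\<in>gball \<Gamma> x 1. gball \<Gamma> y r)"
  then show "z \<in> gball \<Gamma> x (Suc r)" using gball_trans[of _ \<Gamma> x 1] by auto
qed

lemma gball_sym:
  assumes "sym \<Gamma>"
  shows "y \<in> gball \<Gamma> x r \<longleftrightarrow> x \<in> gball \<Gamma> y r"
proof -
  have "(y, x) \<in> \<Gamma> ^^ n" if "(x, y) \<in> \<Gamma> ^^ n" for x y n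
  proof -
    have "(\<Gamma> ^^ n)\<inverse> = (\<Gamma>\<inverse>) ^^ n" by (induction n) (auto simp: converse_relcomp relpow_commute)
    moreover have "\<Gamma>\<inverse> = \<Gamma>" using assms by (simp add: sym_conv_converse_eq)
    ultimately show ?thesis using that by (metis converse_iff)
  qed
  then show ?thesis by (auto simp: gball_def)
qed

lemma gball_subset_carrier: "\<Gamma> \<subseteq> X \<times> X \<Longrightarrow> x \<in> X \<Longrightarrow> gball \<Gamma> x r \<subseteq> X"
proof (induction r arbitrary: x)
  case 0
  then show ?case by (auto simp: gball_def)
next
  case (Suc r)
  have "gball \<Gamma> x 1 \<subseteq> X" using Suc.prems by (auto simp: gball_1)
  then show ?case using Suc unfolding gball_Suc by blast
qed

lemma gball_finite:
  assumes "\<Gamma> \<subseteq> X \<times> X" "\<And>x. x \<in> X \<Longrightarrow> finite {y. (x, y) \<in> \<Gamma>}"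
  shows "x \<in> X \<Longrightarrow> finite (gball \<Gamma> x r)"
proof (induction r arbitrary: x)
  case 0
  then show ?case by (auto simp: gball_def)
next
  case (Suc r)
  have "finite (gball \<Gamma> x 1)" using assms(2) Suc.prems by (auto simp: gball_1)
  then show ?case using Suc.IH gball_subset_carrier[OF assms(1) Suc.prems, of 1] unfolding gball_Suc by blast
qed

text \<open>In the proof of \<open>ex_deep\<close> below a point needs depth \<open>4 * (k + 1)\<close> for some \<open>k \<le> i\<close> in a cell which
  absorbs its cell of level \<open>i\<close>, where 4 is the gap between the boundaries of two cores.\<close>

definition shift :: "nat \<Rightarrow> nat" where "shift i = 4 * (i + 1)"
definition radius :: "nat \<Rightarrow> nat" where "radius i = 4 * i ^ 2"

lemma radius_Suc: "radius i + shift i \<le> radius (Suc i)"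
  by (simp add: radius_def shift_def power2_eq_square)

lemma radius_mono: "i \<le> j \<Longrightarrow> radius i \<le> radius j"
  by (simp add: radius_def power_mono)

lemma shift_mono: "i \<le> j \<Longrightarrow> shift i \<le> shift j"
  by (simp add: shift_def)

lemma radius_ge: "i \<le> radius i"
  by (cases i) (simp_all add: radius_def power2_eq_square)

text \<open>The bound \<open>q_ge\<close> makes the neighbourhood of a cell of any level below
  \<open>n\<close> fit into a ball on which the multiplicity of \<open>E n\<close> is at most
  \<open>b\<close>, as long as the start of its center is at most \<open>n\<close>.\<close>

locale coarse_scales =
  fixes X :: "'a set" and \<Gamma> :: "('a \<times> 'a) set" and E :: "nat \<Rightarrow> ('a \<times> 'a) set"
    and D q :: "nat \<Rightarrow> nat" and b :: nat
  assumes sym_\<Gamma>: "sym \<Gamma>" and \<Gamma>_sub: "\<Gamma> \<subseteq> X \<times> X"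
    and fin_\<Gamma>: "x \<in> X \<Longrightarrow> finite {y. (x, y) \<in> \<Gamma>}"
    and E_equiv: "equiv X (E n)" and E_Suc: "E n \<subseteq> E (Suc n)"
    and E_bounded: "(x, y) \<in> E n \<Longrightarrow> y \<in> gball \<Gamma> x (D n)"
    and E_mult: "x \<in> X \<Longrightarrow> card ((\<lambda>y. E n `` {y}) ` gball \<Gamma> x (q n)) \<le> b"
    and q_ge: "i < n \<Longrightarrow> D i + 2 * radius n + shift n \<le> q n"
begin

abbreviation "B \<equiv> gball \<Gamma>"

section \<open>Cells, absorption times and cores\<close>

definition cls :: "nat \<Rightarrow> 'a set \<Rightarrow> 'a set set" where
  "cls n A = (\<lambda>y. E n `` {y}) ` A"

text \<open>For each radius the number of classes decreases with the scale \<open>n\<close>, so this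
  is the supremum over the radii of the limits in \<open>n\<close>.\<close>

definition class_index :: "'a \<Rightarrow> nat" where
  "class_index x = (LEAST m. \<forall>i. \<exists>n. card (cls n (B x (radius i))) \<le> m)"

definition start :: "'a \<Rightarrow> nat" where
  "start x = (LEAST i. \<forall>n. class_index x \<le> card (cls n (B x (radius i))))"

definition trace :: "nat \<Rightarrow> 'a \<Rightarrow> 'a set set" where
  "trace n x = cls n (B x (radius (start x)))"

definition cell :: "nat \<Rightarrow> 'a \<Rightarrow> 'a set" where
  "cell n x = {y \<in> X. trace n y = trace n x}"

text \<open>The thickness leaves room to move \<open>shift i\<close> steps away and still contain
  the ball that determines the trace of the point reached; \<open>captured\<close> relies on
  this.\<close>

definition cell_nbhd :: "'a \<Rightarrow> nat \<Rightarrow> 'a set" where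
  "cell_nbhd x i = (\<Union>y\<in>cell i x. B y (shift i + radius (Suc i)))"

text \<open>From this scale on the neighbourhood meets no more classes than the limit. A ball inside
  it that attains the limit then meets all of its classes.\<close>

definition absorb_time :: "'a \<Rightarrow> nat \<Rightarrow> nat" where
  "absorb_time x i = (LEAST n. i < n \<and> card (cls n (cell_nbhd x i)) \<le> class_index x)"

text \<open>Levels without a jump are skipped, because only a strict jump forces the class sets of
  two levels apart in \<open>key_count_bounded\<close>.\<close>

definition key_level :: "'a \<Rightarrow> nat \<Rightarrow> bool" where
  "key_level x i \<longleftrightarrow> absorb_time x i < absorb_time x (Suc i)"

definition key_count :: "'a \<Rightarrow> nat \<Rightarrow> nat \<Rightarrow> nat" where
  "key_count x u v = card {w \<in> {u..<v}. key_level x w}"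

definition deep :: "'a \<Rightarrow> nat \<Rightarrow> bool" where
  "deep x u \<longleftrightarrow> key_level x u \<and> (\<forall>v\<ge>u. key_level x v \<longrightarrow> B x (4 * (key_count x u v + 1)) \<subseteq> cell v x)"

definition core :: "'a \<Rightarrow> nat \<Rightarrow> 'a set" where
  "core x u = {y \<in> cell u x. deep y u}"

definition core_boundary :: "'a \<Rightarrow> bool" where
  "core_boundary x \<longleftrightarrow> (\<exists>u. deep x u \<and> \<not> B x 1 \<subseteq> core x u)"

lemmas B_sym = gball_sym[OF sym_\<Gamma>]
  and B_sub = gball_subset_carrier[OF \<Gamma>_sub]

lemma B_finite: "x \<in> X \<Longrightarrow> finite (B x r)"
  by (rule gball_finite[OF \<Gamma>_sub]) (rule fin_\<Gamma>)

lemma E_mono: "m \<le> n \<Longrightarrow> E m \<subseteq> E n"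
  using E_Suc by (rule lift_Suc_mono_le)

lemma E_image: "m \<le> n \<Longrightarrow> y \<in> X \<Longrightarrow> E n `` (E m `` {y}) = E n `` {y}"
proof -
  assume mn: "m \<le> n" and y: "y \<in> X"
  have "(y, y) \<in> E m" using E_equiv y by (simp add: equiv_def refl_on_def)
  moreover have "trans (E n)" using E_equiv by (simp add: equiv_def)
  ultimately show ?thesis using E_mono[OF mn] by (fastforce dest: transD)
qed

lemma cls_image: "m \<le> n \<Longrightarrow> A \<subseteq> X \<Longrightarrow> cls n A = (\<lambda>Q. E n `` Q) ` cls m A"
  unfolding cls_def image_image by (rule image_cong[OF refl], rule E_image[symmetric]) auto

lemma cls_mono: "A \<subseteq> A' \<Longrightarrow> cls n A \<subseteq> cls n A'"
  unfolding cls_def by (rule image_mono)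

lemma cls_finite: "finite A \<Longrightarrow> finite (cls n A)"
  unfolding cls_def by simp

lemma card_cls_antimono: "m \<le> n \<Longrightarrow> A \<subseteq> X \<Longrightarrow> finite A \<Longrightarrow> card (cls n A) \<le> card (cls m A)"
  using cls_image[of m n A] cls_finite card_image_le by metis

lemma card_cls_mono: "A \<subseteq> A' \<Longrightarrow> finite A' \<Longrightarrow> card (cls n A) \<le> card (cls n A')"
  by (intro card_mono cls_finite cls_mono)

section \<open>The limiting number of classes met by balls\<close>

lemma mult_bound:
  assumes "x \<in> X" "A \<subseteq> B x (q n)"
  shows "card (cls n A) \<le> b"
  using card_cls_mono[OF assms(2) B_finite[OF assms(1)]] E_mult[OF assms(1), of n]
  unfolding cls_def by (rule le_trans)

text \<open>The least value exists because \<open>radius i\<close> is at most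
  \<open>q (Suc i)\<close>, so \<open>b\<close> is an admissible bound for every radius.\<close>

lemma class_index_le:
  assumes x: "x \<in> X"
  shows "\<exists>n. card (cls n (B x (radius i))) \<le> class_index x"
proof -
  have "\<exists>n. card (cls n (B x (radius i))) \<le> b" for i
  proof -
    have "radius i \<le> q (Suc i)" using q_ge[of i "Suc i"] radius_mono[of i "Suc i"] by simp
    then show ?thesis using mult_bound[OF x gball_mono] by blast
  qed
  then have "\<exists>m. \<forall>i. \<exists>n. card (cls n (B x (radius i))) \<le> m" by blast
  from LeastI_ex[OF this] show ?thesis unfolding class_index_def by blast
qed

text \<open>A ball around one point lies in a ball around the other whose radius is larger by their
  distance, and all radii enter the supremum.\<close>

lemma class_index_cong:
  assumes "x \<in> X" "y \<in> B x r"
  shows "class_index y = class_index x"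
proof -
  have *: "\<exists>n. card (cls n (B x (radius i))) \<le> m"
    if "x \<in> X" "y \<in> B x r" "\<forall>i. \<exists>n. card (cls n (B y (radius i))) \<le> m" for x y m i
  proof -
    have y: "y \<in> X" using B_sub that by blast
    from that(3) obtain n where n: "card (cls n (B y (radius (r + radius i)))) \<le> m" by blast
    have "B x (radius i) \<subseteq> B y (radius (r + radius i))"
      using that(2) radius_ge by (intro gball_subset[of _ _ _ r]) (auto simp: B_sym)
    from card_cls_mono[OF this B_finite[OF y], of n] n show ?thesis by (meson le_trans)
  qed
  have "y \<in> X" "x \<in> B y r" using B_sub[OF assms(1)] assms(2) B_sym by blast+
  then show ?thesis unfolding class_index_def using * assms by (intro arg_cong[of _ _ Least] ext) blast
qed

text \<open>If the number of classes dropped below \<open>class_index x\<close> for every radius,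
  \<open>class_index x - 1\<close> would satisfy the defining condition too.\<close>

lemma start_ge:
  assumes x: "x \<in> X"
  shows "class_index x \<le> card (cls n (B x (radius (start x))))"
proof -
  have "\<exists>i. \<forall>n. class_index x \<le> card (cls n (B x (radius i)))"
  proof (rule ccontr)
    assume "\<not> ?thesis"
    then have c: "\<And>i. \<exists>n. card (cls n (B x (radius i))) < class_index x" by (auto simp: not_le)
    then have "class_index x > 0" by (metis gr0I not_less_zero)
    moreover have "\<forall>i. \<exists>n. card (cls n (B x (radius i))) \<le> class_index x - 1"
      using c by (metis Suc_pred' calculation less_Suc_eq_le)
    then have "class_index x \<le> class_index x - 1" unfolding class_index_def by (rule Least_le)
    ultimately show False by simp
  qed
  from LeastI_ex[OF this] show ?thesis unfolding start_def by blast
qed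

section \<open>Monotonicity and finiteness of the cells\<close>

lemma trace_image: "m \<le> n \<Longrightarrow> x \<in> X \<Longrightarrow> trace n x = (\<lambda>Q. E n `` Q) ` trace m x"
  unfolding trace_def by (rule cls_image[OF _ B_sub])

lemma cell_mono: "m \<le> n \<Longrightarrow> x \<in> X \<Longrightarrow> cell m x \<subseteq> cell n x"
  unfolding cell_def using trace_image by auto

lemma cell_self: "x \<in> X \<Longrightarrow> x \<in> cell n x"
  by (simp add: cell_def)

lemma cell_sub: "cell n x \<subseteq> X"
  by (auto simp: cell_def)

lemma cell_eq: "y \<in> cell n x \<Longrightarrow> cell n y = cell n x"
  by (auto simp: cell_def)

lemma cell_eq_mono: "x \<in> X \<Longrightarrow> y \<in> cell m x \<Longrightarrow> m \<le> n \<Longrightarrow> cell n y = cell n x"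
  using cell_mono cell_eq by blast

text \<open>The class of \<open>y\<close> belongs to its own trace, hence to that of
  \<open>x\<close>. So \<open>y\<close> shares a class of diameter at most \<open>D n\<close> with a
  point of the ball around \<open>x\<close>.\<close>

lemma cell_bounded:
  assumes x: "x \<in> X"
  shows "cell n x \<subseteq> B x (radius (start x) + D n)"
proof
  fix y assume "y \<in> cell n x"
  then have y: "y \<in> X" "trace n y = trace n x" by (auto simp: cell_def)
  have "E n `` {y} \<in> trace n y" by (auto simp: trace_def cls_def)
  then have "E n `` {y} \<in> trace n x" using y(2) by simp
  then obtain z where z: "z \<in> B x (radius (start x))" "E n `` {y} = E n `` {z}"
    unfolding trace_def cls_def by blast
  then have "z \<in> X" using B_sub x by blast
  then have "(z, y) \<in> E n" using eq_equiv_class_iff[OF E_equiv] z(2) y(1) by metis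
  then show "y \<in> B x (radius (start x) + D n)" using gball_trans[OF z(1) E_bounded] by blast
qed

lemma cell_finite: "x \<in> X \<Longrightarrow> finite (cell n x)"
  using cell_bounded B_finite finite_subset by metis

section \<open>Neighbourhoods of cells and their absorption\<close>

lemma cell_nbhd_bounded:
  assumes x: "x \<in> X"
  shows "cell_nbhd x i \<subseteq> B x (radius (start x) + D i + (shift i + radius (Suc i)))"
  unfolding cell_nbhd_def using cell_bounded[OF x] gball_subset[OF _ order_refl] by fast

lemma cell_nbhd_finite: "x \<in> X \<Longrightarrow> finite (cell_nbhd x i)"
  using cell_nbhd_bounded B_finite finite_subset by metis

lemma cell_nbhd_sub: "cell_nbhd x i \<subseteq> X"
  unfolding cell_nbhd_def using cell_sub B_sub by blast

lemma cell_nbhd_mono: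
  assumes "x \<in> X" "i \<le> j"
  shows "cell_nbhd x i \<subseteq> cell_nbhd x j"
  unfolding cell_nbhd_def
  using cell_mono[OF assms(2,1)] assms(2)
  by (intro UN_mono gball_mono add_mono shift_mono radius_mono) auto

lemma cell_nbhd_cong: "y \<in> cell i x \<Longrightarrow> cell_nbhd y i = cell_nbhd x i"
  unfolding cell_nbhd_def using cell_eq by metis

lemma cell_class_index: "x \<in> X \<Longrightarrow> y \<in> cell i x \<Longrightarrow> class_index y = class_index x"
  using cell_bounded class_index_cong by blast

lemma absorb_time_cong: "x \<in> X \<Longrightarrow> y \<in> cell i x \<Longrightarrow> absorb_time y i = absorb_time x i"
  unfolding absorb_time_def using cell_nbhd_cong cell_class_index by metis

text \<open>The neighbourhood lies in some ball, for which \<open>class_index_le\<close> provides a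
  scale. The bound persists at larger scales because merging classes cannot increase their
  number.\<close>

lemma absorb_time_props:
  assumes x: "x \<in> X"
  shows "i < absorb_time x i" "absorb_time x i \<le> n \<Longrightarrow> card (cls n (cell_nbhd x i)) \<le> class_index x"
proof -
  define r where "r = radius (start x) + D i + (shift i + radius (Suc i))"
  have sub: "cell_nbhd x i \<subseteq> B x (radius r)"
    unfolding r_def by (rule subset_trans[OF cell_nbhd_bounded[OF x] gball_mono[OF radius_ge]])
  obtain m where m: "card (cls m (B x (radius r))) \<le> class_index x" using class_index_le[OF x] by blast
  have "card (cls (max m (Suc i)) (cell_nbhd x i)) \<le> card (cls m (cell_nbhd x i))"
    by (intro card_cls_antimono cell_nbhd_sub cell_nbhd_finite x) simp
  also have "\<dots> \<le> card (cls m (B x (radius r)))" by (intro card_cls_mono sub B_finite x)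
  finally have "i < max m (Suc i) \<and> card (cls (max m (Suc i)) (cell_nbhd x i)) \<le> class_index x" using m by simp
  from LeastI[of "\<lambda>n. i < n \<and> card (cls n (cell_nbhd x i)) \<le> class_index x", OF this]
  have pending: "i < absorb_time x i" "card (cls (absorb_time x i) (cell_nbhd x i)) \<le> class_index x" unfolding absorb_time_def by auto
  then show "i < absorb_time x i" by simp
  show "card (cls n (cell_nbhd x i)) \<le> class_index x" if "absorb_time x i \<le> n"
    using card_cls_antimono[OF that cell_nbhd_sub cell_nbhd_finite[OF x]] pending(2) by (rule le_trans)
qed

lemma absorb_time_le_iff:
  assumes x: "x \<in> X" and "i < n"
  shows "absorb_time x i \<le> n \<longleftrightarrow> card (cls n (cell_nbhd x i)) \<le> class_index x"
  using absorb_time_props(2)[OF x] Least_le[of "\<lambda>n. i < n \<and> card (cls n (cell_nbhd x i)) \<le> class_index x" n] assms(2)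
  unfolding absorb_time_def by blast

lemma absorb_time_mono:
  assumes x: "x \<in> X" and "i \<le> j"
  shows "absorb_time x i \<le> absorb_time x j"
proof -
  have j: "j < absorb_time x j" "card (cls (absorb_time x j) (cell_nbhd x j)) \<le> class_index x" using absorb_time_props[OF x] by auto
  have "card (cls (absorb_time x j) (cell_nbhd x i)) \<le> class_index x"
    using card_cls_mono[OF cell_nbhd_mono[OF x assms(2)] cell_nbhd_finite[OF x]] j(2) by (rule le_trans)
  then show ?thesis using absorb_time_le_iff[OF x] j(1) assms(2) by simp
qed

text \<open>Both the ball defining the trace of \<open>x\<close> and that of a point
  \<open>y\<close> within \<open>shift i\<close> lie in \<open>cell_nbhd x i\<close> and meet at
  least \<open>class_index x\<close> classes. The neighbourhood meets at most that many, so both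
  traces consist of all its classes.\<close>

lemma captured:
  assumes x: "x \<in> X" and i: "start x \<le> i" and n: "absorb_time x i \<le> n"
  shows "B x (shift i) \<subseteq> cell n x"
proof
  fix y assume y: "y \<in> B x (shift i)"
  have yX: "y \<in> X" using y B_sub x by blast
  have Jy: "class_index y = class_index x" by (rule class_index_cong[OF x y])
  have c: "card (cls n (cell_nbhd x i)) \<le> class_index x" using absorb_time_props[OF x] n by blast
  have sub: "B x (shift i + radius (Suc i)) \<subseteq> cell_nbhd x i"
    unfolding cell_nbhd_def using cell_self[OF x] by blast
  have eq: "trace n z = cls n (cell_nbhd x i)" if "z \<in> X" "B z (radius (start z)) \<subseteq> cell_nbhd x i" "class_index z = class_index x" for z
    unfolding trace_def using cls_mono[OF that(2)] c start_ge[OF that(1), of n] that(3)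
    by (intro card_seteq cls_finite cell_nbhd_finite x) auto
  have "B x (radius (start x)) \<subseteq> cell_nbhd x i"
    using sub gball_mono[of "radius (start x)" "shift i + radius (Suc i)" \<Gamma> x] radius_mono[of "start x" "Suc i"] i by auto
  then have 1: "trace n x = cls n (cell_nbhd x i)" using x by (intro eq) auto
  \<comment> \<open>This is what the growth of \<open>radius\<close> is for: the ball around
    \<open>x\<close> that attains the limit fits into the ball of radius
    \<open>radius (Suc i)\<close> around \<open>y\<close>.\<close>
  have "start y \<le> Suc i"
    unfolding start_def
  proof (rule Least_le, rule allI)
    fix m
    have "class_index x \<le> card (cls m (B x (radius (start x))))" by (rule start_ge[OF x])
    also have "B x (radius (start x)) \<subseteq> B y (radius (Suc i))"
      using y radius_Suc[of i] radius_mono[OF i] by (intro gball_subset[of _ _ _ "shift i"]) (auto simp: B_sym)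
    then have "card (cls m (B x (radius (start x)))) \<le> card (cls m (B y (radius (Suc i))))"
      by (intro card_cls_mono B_finite yX)
    finally show "class_index y \<le> card (cls m (B y (radius (Suc i))))" using Jy by simp
  qed
  then have "B y (radius (start y)) \<subseteq> B x (shift i + radius (Suc i))"
    using y radius_mono by (intro gball_subset) auto
  then have "trace n y = cls n (cell_nbhd x i)" using sub Jy yX by (intro eq) auto
  with 1 yX show "y \<in> cell n x" by (simp add: cell_def)
qed

text \<open>While level \<open>i\<close> is pending, so are all later levels. If the neighbourhoods
  of two key levels met the same classes, both would be absorbed at the same time, against the jump
  at the lower one. The numbers of classes met are therefore distinct values between 1 and
  \<open>b\<close>.\<close>

lemma key_count_bounded:
  assumes x: "x \<in> X" and i: "start x \<le> i" and v: "v < absorb_time x i"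
  shows "key_count x i v \<le> b"
proof -
  \<comment> \<open>The last scale at which level \<open>i\<close> is pending. It exceeds every
    level below \<open>v\<close> that is counted, as \<open>q_ge\<close> requires.\<close>
  define n where "n = absorb_time x i - 1"
  let ?U = "{w \<in> {i..<v}. key_level x w}"
  have hn: "n < absorb_time x w" if "w \<in> ?U" for w
    using absorb_time_mono[OF x, of i w] that absorb_time_props(1)[OF x, of i] by (auto simp: n_def)
  have less: "card (cls n (cell_nbhd x w)) < card (cls n (cell_nbhd x w'))" if "w \<in> ?U" "w' \<in> ?U" "w < w'" for w w'
  proof (rule psubset_card_mono[OF cls_finite[OF cell_nbhd_finite[OF x]]], rule psubsetI)
    show "cls n (cell_nbhd x w) \<subseteq> cls n (cell_nbhd x w')" using that by (intro cls_mono cell_nbhd_mono x) auto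
    show "cls n (cell_nbhd x w) \<noteq> cls n (cell_nbhd x w')"
    proof
      assume eq: "cls n (cell_nbhd x w) = cls n (cell_nbhd x w')"
      have "cls m (cell_nbhd x w) = cls m (cell_nbhd x w')" if "n \<le> m" for m
        using cls_image[OF that cell_nbhd_sub] eq by metis
      then have "card (cls (absorb_time x w) (cell_nbhd x w')) \<le> class_index x"
        using hn[OF that(1)] absorb_time_props(2)[OF x, of w "absorb_time x w"] by simp
      then have "absorb_time x w' \<le> absorb_time x w"
        using absorb_time_le_iff[OF x, of w' "absorb_time x w"] v that hn[OF that(1)] by (auto simp: n_def)
      moreover have "absorb_time x w < absorb_time x (Suc w)" "absorb_time x (Suc w) \<le> absorb_time x w'"
        using that absorb_time_mono[OF x] by (auto simp: key_level_def)
      ultimately show False by simp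
    qed
  qed
  have "inj_on (\<lambda>w. card (cls n (cell_nbhd x w))) ?U"
    by (rule linorder_inj_onI') (use less in fastforce)
  moreover have "(\<lambda>w. card (cls n (cell_nbhd x w))) ` ?U \<subseteq> {1..b}"
  proof (rule image_subsetI)
    fix w assume w: "w \<in> ?U"
    then have wn: "w < n" using v by (auto simp: n_def)
    have "x \<in> cell_nbhd x w" unfolding cell_nbhd_def using cell_self[OF x] by force
    then have "cls n (cell_nbhd x w) \<noteq> {}" by (auto simp: cls_def)
    then have "card (cls n (cell_nbhd x w)) \<ge> 1" using cls_finite[OF cell_nbhd_finite[OF x]] by (simp add: Suc_le_eq card_gt_0_iff)
    moreover have "radius (start x) + D w + (shift w + radius (Suc w)) \<le> q n"
      using q_ge[OF wn] radius_mono[of "start x" n] radius_mono[of "Suc w" n] shift_mono[of w n] i w wn by auto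
    then have "card (cls n (cell_nbhd x w)) \<le> b"
      using cell_nbhd_bounded[OF x, of w] gball_mono mult_bound[OF x] by (meson subset_trans)
    ultimately show "card (cls n (cell_nbhd x w)) \<in> {1..b}" by simp
  qed
  ultimately have "card ?U \<le> card {1..b}" by (rule card_inj_on_le) simp
  then show ?thesis by (simp add: key_count_def)
qed

section \<open>Deep points and the boundaries of cores\<close>

lemma key_level_unbounded:
  assumes x: "x \<in> X"
  shows "\<exists>i\<ge>m. key_level x i"
proof (rule ccontr)
  assume "\<not> ?thesis"
  then have "\<And>i. m \<le> i \<Longrightarrow> absorb_time x (Suc i) \<le> absorb_time x i" by (auto simp: key_level_def not_less)
  then have step: "absorb_time x (Suc (m + k)) \<le> absorb_time x (m + k)" for k by simp
  have "absorb_time x (m + k) \<le> absorb_time x m" for k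
  proof (induction k)
    case (Suc k)
    with step[of k] show ?case by simp
  qed simp
  from this[of "absorb_time x m"] absorb_time_props(1)[OF x, of "m + absorb_time x m"] show False by simp
qed

text \<open>Any key level \<open>u\<close> preceded by more than \<open>b\<close> key levels from
  \<open>start x\<close> on will do. This surplus forces a sufficiently high level to be absorbed by
  the time \<open>v\<close>, whatever \<open>v\<close> is.\<close>

lemma ex_deep:
  assumes x: "x \<in> X"
  shows "\<exists>u. deep x u"
proof -
  have "infinite {w. key_level x w}" using key_level_unbounded[OF x] unfolding infinite_nat_iff_unbounded_le by blast
  then have "infinite ({w. key_level x w} - {..<start x})" by simp
  then obtain W where W: "W \<subseteq> {w. key_level x w} - {..<start x}" "card W = Suc b" "finite W"
    using infinite_arbitrarily_large by blast
  obtain u where u: "u > Max W" "key_level x u" using key_level_unbounded[OF x, of "Suc (Max W)"] Suc_le_lessD by blast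
  have "W \<subseteq> {w \<in> {start x..<u}. key_level x w}"
    using W u by (fastforce dest: Max_ge[OF W(3)])
  then have ku: "b < key_count x (start x) u" using W(2) unfolding key_count_def using card_mono[of "{w \<in> {start x..<u}. key_level x w}" W] by simp
  have "B x (4 * (key_count x u v + 1)) \<subseteq> cell v x" if "u \<le> v" for v
  proof -
    \<comment> \<open>At most \<open>key_count x u v\<close> key levels lie between
      \<open>start x\<close> and \<open>i\<close>, so more than \<open>b\<close> remain between
      \<open>i\<close> and \<open>v\<close>. By \<open>key_count_bounded\<close> level
      \<open>i\<close> is absorbed by \<open>v\<close>, and its shift is at least the required
      depth.\<close>
    define i where "i = start x + key_count x u v"
    have "start x \<le> u"
    proof (rule ccontr)
      assume "\<not> ?thesis"
      then have "{w \<in> {start x..<u}. key_level x w} = {}" by auto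
      with ku show False unfolding key_count_def by (metis card.empty not_less_zero)
    qed
    then have "{w \<in> {start x..<u}. key_level x w} \<union> {w \<in> {u..<v}. key_level x w} = {w \<in> {start x..<v}. key_level x w}"
      using that by auto
    moreover have "card ({w \<in> {start x..<u}. key_level x w} \<union> {w \<in> {u..<v}. key_level x w}) = key_count x (start x) u + key_count x u v"
      unfolding key_count_def by (rule card_Un_disjoint) auto
    ultimately have "key_count x (start x) u + key_count x u v = key_count x (start x) v" by (simp add: key_count_def)
    also have "\<dots> \<le> card ({start x..<i} \<union> {w \<in> {i..<v}. key_level x w})"
      unfolding key_count_def by (rule card_mono) auto
    also have "\<dots> \<le> key_count x u v + key_count x i v"
      using card_Un_le[of "{start x..<i}" "{w \<in> {i..<v}. key_level x w}"] by (simp add: key_count_def i_def)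
    finally have "b < key_count x i v" using ku by simp
    then have "absorb_time x i \<le> v" using key_count_bounded[OF x, of i v] by (auto simp: i_def not_le[symmetric])
    then have "B x (shift i) \<subseteq> cell v x" by (intro captured x) (simp_all add: i_def)
    then show ?thesis using gball_mono[of "4 * (key_count x u v + 1)" "shift i" \<Gamma> x] by (auto simp: shift_def i_def)
  qed
  then show ?thesis using u by (auto simp: deep_def)
qed

lemma key_level_cong:
  assumes x: "x \<in> X" and "y \<in> cell i x" "i \<le> j"
  shows "key_level y j = key_level x j"
proof -
  have "y \<in> cell j x" "y \<in> cell (Suc j) x" using cell_mono[OF _ x] assms by (meson le_SucI subsetD)+
  then show ?thesis unfolding key_level_def using absorb_time_cong[OF x] by metis
qed

lemma key_count_cong:
  assumes "x \<in> X" "y \<in> cell u x"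
  shows "key_count y u v = key_count x u v"
  unfolding key_count_def using key_level_cong[OF assms] by (intro arg_cong[of _ _ card]) auto

text \<open>The required depth grows with the number of key levels in between. This makes every core lie with a
  neighbourhood in the later ones.\<close>

lemma deep_later:
  assumes x: "x \<in> X" and "deep x u" "u < u'" "key_level x u'" "y \<in> B x 4"
  shows "deep y u'" "y \<in> cell u' x"
proof -
  have key_count: "key_count x u' v + 1 \<le> key_count x u v" if "u' \<le> v" for v
  proof -
    have "insert u {w \<in> {u'..<v}. key_level x w} \<subseteq> {w \<in> {u..<v}. key_level x w}"
      using assms that by (auto simp: deep_def)
    from card_mono[OF _ this] show ?thesis using \<open>u < u'\<close> by (simp add: key_count_def)
  qed
  have sub: "B y (4 * (key_count x u' v + 1)) \<subseteq> cell v x" if "u' \<le> v" "key_level x v" for v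
  proof -
    have "B y (4 * (key_count x u' v + 1)) \<subseteq> B x (4 * (key_count x u v + 1))"
      using key_count[OF that(1)] by (intro gball_subset[OF assms(5)]) simp
    also have "\<dots> \<subseteq> cell v x" using assms(2,3) that by (simp add: deep_def)
    finally show ?thesis .
  qed
  show yC: "y \<in> cell u' x" using sub[of u'] assms by auto
  show "deep y u'" unfolding deep_def
    using sub key_level_cong[OF x yC] key_count_cong[OF x yC] cell_eq_mono[OF x yC] assms(4) by auto
qed

lemma deep_ball:
  assumes "deep x u"
  shows "B x 4 \<subseteq> cell u x"
  using assms gball_mono[of 4 "4 * (key_count x u u + 1)" \<Gamma> x] unfolding deep_def by auto

text \<open>At equal levels both points lie in one cell. Otherwise \<open>deep_later\<close> puts
  the ball of radius 4 around \<open>x\<close> into the later core, and with it all neighbours of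
  \<open>y\<close>, since 3 + 1 = 4; then \<open>y\<close> would not be a boundary point.\<close>

lemma boundary_unique:
  assumes x: "x \<in> X" and xu: "deep x u" and y: "y \<in> B x 3" and yu: "deep y u'" "\<not> B y 1 \<subseteq> core y u'" and le: "u \<le> u'"
  shows "core y u' = core x u"
proof (cases "u = u'")
  case True
  have "y \<in> cell u x" using deep_ball[OF xu] y gball_mono[of 3 4] by fastforce
  then show ?thesis using True by (simp add: core_def cell_eq)
next
  case False
  then have less: "u < u'" using le by simp
  have yX: "y \<in> X" using y B_sub x by blast
  have "x \<in> B y 4" using y B_sym gball_mono[of 3 4] by fastforce
  then have xC: "x \<in> cell u' y" using deep_ball[OF yu(1)] by blast
  have ux: "key_level x u'" using key_level_cong[OF yX xC] yu(1) by (simp add: deep_def)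
  obtain z where z: "z \<in> B y 1" "z \<notin> core y u'" using yu(2) by blast
  then have "z \<in> B x 4" using gball_trans[OF y z(1)] by simp
  from deep_later[OF x xu less ux this] z(2) cell_eq[OF xC] show ?thesis by (simp add: core_def)
qed

text \<open>A walk starting in a core cannot leave it without meeting \<^term>\<open>core_boundary\<close>, and the boundaries
  of two different cores are more than three steps apart.\<close>

lemma finite_component_outside_core_boundary:
  assumes x: "x \<in> X" and A: "\<And>y. y \<in> A \<Longrightarrow> \<not> core_boundary y"
  shows "finite {y. (x, y) \<in> (\<Gamma> \<inter> A \<times> A)\<^sup>*}"
proof -
  obtain u where u: "deep x u" using ex_deep[OF x] by blast
  have "y \<in> core x u" if "(x, y) \<in> (\<Gamma> \<inter> A \<times> A)\<^sup>*" for y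
    using that
  proof induction
    case base
    then show ?case using cell_self[OF x] u by (simp add: core_def)
  next
    case (step y z)
    have "deep y u" "y \<in> cell u x" using step by (auto simp: core_def)
    then have "core y u = core x u" by (simp add: core_def cell_eq)
    moreover have "B y 1 \<subseteq> core y u" using A[of y] step(2) \<open>deep y u\<close> unfolding core_boundary_def by blast
    ultimately show ?case using step(2) by (auto simp: gball_1)
  qed
  then have "{y. (x, y) \<in> (\<Gamma> \<inter> A \<times> A)\<^sup>*} \<subseteq> cell u x" by (auto simp: core_def)
  then show ?thesis using cell_finite[OF x] finite_subset by blast
qed

text \<open>Boundary points next to two adjacent points of \<open>A\<close> are at most three steps
  apart, so \<open>boundary_unique\<close> gives them the same core. The whole component stays
  within one step of that finite core.\<close>

lemma finite_component_near_core_boundary: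
  assumes x: "x \<in> A" and A: "\<And>y. y \<in> A \<Longrightarrow> y \<in> X \<and> (\<exists>z\<in>B y 1. core_boundary z)"
  shows "finite {y. (x, y) \<in> (\<Gamma> \<inter> A \<times> A)\<^sup>*}"
proof -
  obtain z u where z: "z \<in> B x 1" "deep z u" "\<not> B z 1 \<subseteq> core z u"
    using A[OF x] by (auto simp: core_boundary_def)
  have zX: "z \<in> X" using z(1) B_sub A[OF x] by blast
  define S where "S = (\<Union>y\<in>core z u. B y 1)"
  have "\<exists>w v. y \<in> B w 1 \<and> w \<in> X \<and> deep w v \<and> \<not> B w 1 \<subseteq> core w v \<and> core w v = core z u"
    if "(x, y) \<in> (\<Gamma> \<inter> A \<times> A)\<^sup>*" for y
    using that
  proof induction
    case base
    then show ?case using z zX B_sym by blast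
  next
    case (step y y')
    then obtain w v where w: "y \<in> B w 1" "w \<in> X" "deep w v" "\<not> B w 1 \<subseteq> core w v" "core w v = core z u" by blast
    have y': "y' \<in> B y 1" "y' \<in> A" using step(2) by (auto simp: gball_1)
    then obtain w' v' where w': "w' \<in> B y' 1" "deep w' v'" "\<not> B w' 1 \<subseteq> core w' v'"
      using A[of y'] by (auto simp: core_boundary_def)
    have near: "w' \<in> B w 3" using gball_trans[OF gball_trans[OF w(1) y'(1)] w'(1)] by (simp add: numeral_3_eq_3)
    have w'X: "w' \<in> X" using near w(2) B_sub by blast
    have "core w' v' = core w v"
    proof (cases "v \<le> v'")
      case True
      then show ?thesis by (rule boundary_unique[OF w(2,3) near w'(2,3)])
    next
      case False
      then show ?thesis
        using boundary_unique[OF w'X w'(2) _ w(3,4)] near B_sym by fastforce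
    qed
    then show ?case using w' w'X w(5) B_sym by blast
  qed
  moreover have "w \<in> core w v" if "w \<in> X" "deep w v" for w v
    using that cell_self by (simp add: core_def)
  ultimately have "{y. (x, y) \<in> (\<Gamma> \<inter> A \<times> A)\<^sup>*} \<subseteq> S" unfolding S_def by blast
  moreover have "finite S" unfolding S_def
  proof (rule finite_UN_I)
    show "finite (core z u)" using cell_finite[OF zX, of u] by (simp add: core_def)
    show "finite (B y 1)" if "y \<in> core z u" for y using B_finite cell_sub that unfolding core_def by blast
  qed
  ultimately show ?thesis by (rule finite_subset)
qed

end

section \<open>Borel colorings\<close>

lemma measurable_nat_rel:
  assumes [measurable]: "f \<in> M \<rightarrow>\<^sub>M count_space UNIV" "g \<in> M \<rightarrow>\<^sub>M count_space UNIV"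
  shows "Measurable.pred M (\<lambda>x. R (f x :: nat) (g x :: nat))"
proof (rule measurable_compose_countable[where f="\<lambda>i x. R i (g x)" and g=f])
  fix i
  show "Measurable.pred M (\<lambda>x. R i (g x))"
    by (rule measurable_compose[OF assms(2)]) simp
qed fact

lemma pred_measurable_nat_le:
  fixes f :: "'a \<Rightarrow> nat"
  assumes "\<And>m. Measurable.pred M (\<lambda>x. f x \<le> m)"
  shows "f \<in> M \<rightarrow>\<^sub>M count_space UNIV"
proof -
  have "(\<lambda>x. LEAST m. f x \<le> m) \<in> M \<rightarrow>\<^sub>M count_space UNIV" using assms by measurable
  moreover have "(LEAST m. f x \<le> m) = f x" for x by (rule Least_equality) auto
  ultimately show ?thesis by simp
qed

lemma pred_card_measurable:
  assumes "\<And>w. Measurable.pred M (\<lambda>x. Q x w)"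
  shows "(\<lambda>x. card {w \<in> {u..<v::nat}. Q x w}) \<in> M \<rightarrow>\<^sub>M count_space UNIV"
proof (rule pred_measurable_nat_le)
  fix m
  note assms[measurable]
  have "card {w \<in> {u..<v}. Q x w} \<le> m \<longleftrightarrow> (\<exists>T\<in>{T. T \<subseteq> {u..<v} \<and> card T \<le> m}. \<forall>w\<in>{u..<v}. Q x w \<longleftrightarrow> w \<in> T)" for x
  proof
    assume "card {w \<in> {u..<v}. Q x w} \<le> m"
    then show "\<exists>T\<in>{T. T \<subseteq> {u..<v} \<and> card T \<le> m}. \<forall>w\<in>{u..<v}. Q x w \<longleftrightarrow> w \<in> T"
      by (intro bexI[of _ "{w \<in> {u..<v}. Q x w}"]) auto
  next
    assume "\<exists>T\<in>{T. T \<subseteq> {u..<v} \<and> card T \<le> m}. \<forall>w\<in>{u..<v}. Q x w \<longleftrightarrow> w \<in> T"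
    then obtain T where T: "T \<subseteq> {u..<v}" "card T \<le> m" "\<forall>w\<in>{u..<v}. Q x w \<longleftrightarrow> w \<in> T" by blast
    then have "{w \<in> {u..<v}. Q x w} = T" by auto
    then show "card {w \<in> {u..<v}. Q x w} \<le> m" using T by simp
  qed
  moreover have "Measurable.pred M (\<lambda>x. \<exists>T\<in>{T. T \<subseteq> {u..<v} \<and> card T \<le> m}. \<forall>w\<in>{u..<v}. Q x w \<longleftrightarrow> w \<in> T)"
    by (intro pred_intros_finite) measurable
  ultimately show "Measurable.pred M (\<lambda>x. card {w \<in> {u..<v}. Q x w} \<le> m)" by simp
qed

text \<open>The words form a countable family of Borel maps whose values at \<open>x\<close> exhaust
  its component. Quantifiers over points of a component become countable quantifiers over
  words.\<close>

primrec word :: "(nat \<Rightarrow> 'a \<Rightarrow> 'a) \<Rightarrow> nat list \<Rightarrow> 'a \<Rightarrow> 'a" where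
  "word f [] x = x"
| "word f (i # w) x = word f w (f i x)"

locale borel_system =
  fixes M :: "'a measure" and \<Gamma> :: "('a \<times> 'a) set" and f :: "nat \<Rightarrow> 'a \<Rightarrow> 'a" and \<phi> :: "'a \<Rightarrow> real"
  assumes f_meas: "f i \<in> M \<rightarrow>\<^sub>M M"
    and f_range: "x \<in> space M \<Longrightarrow> (\<lambda>i. f i x) ` UNIV = insert x {y. (x, y) \<in> \<Gamma>}"
    and \<phi>_meas: "\<phi> \<in> borel_measurable M" and \<phi>_inj: "inj_on \<phi> (space M)"
    and \<Gamma>_meas: "\<Gamma> \<in> sets (M \<Otimes>\<^sub>M M)"
begin

abbreviation "g \<equiv> word f"

declare \<phi>_meas [measurable]

lemma g_meas [measurable]: "g w \<in> M \<rightarrow>\<^sub>M M"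
proof (induction w)
  case (Cons i w)
  then show ?case using measurable_compose[OF f_meas] by simp
qed simp

lemma g_space: "x \<in> space M \<Longrightarrow> g w x \<in> space M"
  using measurable_space[OF g_meas] .

text \<open>Words of length exactly \<open>r\<close> suffice, because at every point some
  \<open>f i\<close> stands still.\<close>

lemma gball_eq: "x \<in> space M \<Longrightarrow> gball \<Gamma> x r = {g w x | w. length w = r}"
proof (induction r arbitrary: x)
  case 0
  then show ?case by (auto simp: gball_def)
next
  case (Suc r)
  have "gball \<Gamma> x 1 = (\<lambda>i. f i x) ` UNIV" using f_range[OF Suc.prems] by (simp add: gball_1)
  moreover have "gball \<Gamma> (f i x) r = {g w (f i x) | w. length w = r}" for i
    using Suc measurable_space[OF f_meas] by blast
  ultimately have "gball \<Gamma> x (Suc r) = (\<Union>i. {g w (f i x) | w. length w = r})"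
    unfolding gball_Suc by simp
  also have "\<dots> = {g w x | w. length w = Suc r}"
    by (auto simp: length_Suc_conv) (metis word.simps(2))+
  finally show ?case .
qed

lemma gball_comp: "x \<in> space M \<Longrightarrow> gball \<Gamma> x r \<subseteq> range (\<lambda>w. g w x)"
  using gball_eq by auto

text \<open>Borelness in the form in which it is used: substituting Borel maps, such as words,
  leaves a Borel predicate of one point. Membership in the product algebra implies it by
  \<open>borel2_set\<close>.\<close>

definition borel2 :: "('a \<Rightarrow> 'a \<Rightarrow> bool) \<Rightarrow> bool" where
  "borel2 R \<longleftrightarrow> (\<forall>a\<in>M \<rightarrow>\<^sub>M M. \<forall>b\<in>M \<rightarrow>\<^sub>M M. Measurable.pred M (\<lambda>x. R (a x) (b x)))"

lemma borel2D: "borel2 R \<Longrightarrow> a \<in> M \<rightarrow>\<^sub>M M \<Longrightarrow> b \<in> M \<rightarrow>\<^sub>M M \<Longrightarrow> Measurable.pred M (\<lambda>x. R (a x) (b x))"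
  by (simp add: borel2_def)

lemma borel2_set:
  assumes R: "R \<in> sets (M \<Otimes>\<^sub>M M)"
  shows "borel2 (\<lambda>x y. (x, y) \<in> R)"
  unfolding borel2_def
proof (intro ballI)
  fix a b assume ab: "a \<in> M \<rightarrow>\<^sub>M M" "b \<in> M \<rightarrow>\<^sub>M M"
  have "(\<lambda>x. (a x, b x)) -` R \<inter> space M \<in> sets M"
    by (rule measurable_sets[OF measurable_Pair[OF ab] R])
  then show "Measurable.pred M (\<lambda>x. (a x, b x) \<in> R)" by (simp add: pred_def vimage_def Int_def conj_commute)
qed

text \<open>The injective code reduces equality of points to equality of real numbers.\<close>

lemma borel2_eq: "borel2 (=)"
  unfolding borel2_def
proof (intro ballI)
  fix a b assume ab [measurable]: "a \<in> M \<rightarrow>\<^sub>M M" "b \<in> M \<rightarrow>\<^sub>M M"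
  have "Measurable.pred M (\<lambda>x. \<phi> (a x) = \<phi> (b x))" by measurable
  moreover have "\<phi> (a x) = \<phi> (b x) \<longleftrightarrow> a x = b x" if "x \<in> space M" for x
    using \<phi>_inj measurable_space[OF ab(1) that] measurable_space[OF ab(2) that] by (auto dest: inj_onD)
  ultimately show "Measurable.pred M (\<lambda>x. a x = b x)" by (simp cong: measurable_cong)
qed

text \<open>The leader of a finite class is its point of least code.\<close>

lemma borel_leader:
  assumes R: "borel2 R"
    and comp: "\<And>x y. x \<in> space M \<Longrightarrow> R x y \<Longrightarrow> y \<in> range (\<lambda>w. g w x)"
    and fin: "\<And>x. x \<in> space M \<Longrightarrow> finite {y. R x y}"
    and R_refl: "\<And>x. x \<in> space M \<Longrightarrow> R x x"
    and cong: "\<And>x y z. x \<in> space M \<Longrightarrow> R x y \<Longrightarrow> R x z \<longleftrightarrow> R y z"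
  obtains l where "l \<in> M \<rightarrow>\<^sub>M M" "\<And>x. x \<in> space M \<Longrightarrow> R x (l x)"
    "\<And>x y. x \<in> space M \<Longrightarrow> R x y \<Longrightarrow> l x = l y"
proof -
  define low where "low x w \<longleftrightarrow> R x (g w x) \<and> (\<forall>v. R x (g v x) \<longrightarrow> \<phi> (g w x) \<le> \<phi> (g v x))" for x w
  note borel2D[OF R measurable_ident_sets[OF refl] g_meas, measurable]
  have low_meas [measurable]: "Measurable.pred M (\<lambda>x. low x w)" for w
    unfolding low_def by measurable
  define k where "k x = (LEAST k. low x (from_nat k))" for x
  have k_meas: "k \<in> M \<rightarrow>\<^sub>M count_space UNIV" unfolding k_def by measurable
  define l where "l x = g (from_nat (k x)) x" for x
  have l_meas: "l \<in> M \<rightarrow>\<^sub>M M" unfolding l_def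
    by (rule measurable_compose_countable[where f="\<lambda>k x. g (from_nat k) x", OF g_meas k_meas])
  have l: "R x (l x)" "R x y \<Longrightarrow> \<phi> (l x) \<le> \<phi> y" if x: "x \<in> space M" for x y
  proof -
    have "finite (\<phi> ` {y. R x y})" "\<phi> ` {y. R x y} \<noteq> {}" using fin[OF x] R_refl[OF x] by auto
    from Min_in[OF this] obtain y where y: "R x y" "\<phi> y = Min (\<phi> ` {y. R x y})" by auto
    then have ymin: "\<phi> y \<le> \<phi> z" if "R x z" for z using that fin[OF x] by auto
    obtain w where "y = g w x" using comp[OF x y(1)] by auto
    then have "low x (from_nat (to_nat w))" using y ymin by (simp add: low_def)
    then have "low x (from_nat (k x))" unfolding k_def by (rule LeastI)
    then show "R x (l x)" "R x y \<Longrightarrow> \<phi> (l x) \<le> \<phi> y" for y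
      using comp[OF x] unfolding low_def l_def by auto
  qed
  have "l x = l y" if x: "x \<in> space M" and xy: "R x y" for x y
  proof -
    have y: "y \<in> space M" using comp[OF x xy] g_space[OF x] by auto
    have lx: "R y (l x)" and ly: "R x (l y)" using l(1) x y cong[OF x xy] by auto
    have "\<phi> (l x) = \<phi> (l y)" using l(2)[OF x ly] l(2)[OF y lx] by simp
    moreover have "l x \<in> space M" "l y \<in> space M" using measurable_space[OF l_meas] x y by auto
    ultimately show ?thesis using \<phi>_inj by (auto dest: inj_onD)
  qed
  with l_meas l(1) that show ?thesis by blast
qed

text \<open>The first step of a walk is one of the maps \<open>f i\<close>, so the existence of an
  intermediate vertex is a countable union.\<close>

lemma borel2_rtrancl:
  assumes A: "A \<in> sets M"
  shows "borel2 (\<lambda>x y. (x, y) \<in> (\<Gamma> \<inter> A \<times> A)\<^sup>*)"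
proof -
  let ?R = "\<Gamma> \<inter> A \<times> A"
  have R: "borel2 (\<lambda>x y. (x, y) \<in> ?R)" using \<Gamma>_meas A by (intro borel2_set) auto
  have "borel2 (\<lambda>x y. (x, y) \<in> ?R ^^ n)" for n
  proof (induction n)
    case 0
    then show ?case using borel2_eq by simp
  next
    case (Suc n)
    show ?case unfolding borel2_def
    proof (intro ballI)
      fix a b assume ab: "a \<in> M \<rightarrow>\<^sub>M M" "b \<in> M \<rightarrow>\<^sub>M M"
      have fa: "(\<lambda>x. f i (a x)) \<in> M \<rightarrow>\<^sub>M M" for i by (rule measurable_compose[OF ab(1) f_meas])
      note borel2D[OF R ab(1) fa, measurable] borel2D[OF Suc fa ab(2), measurable]
      have "Measurable.pred M (\<lambda>x. \<exists>i. (a x, f i (a x)) \<in> ?R \<and> (f i (a x), b x) \<in> ?R ^^ n)" by measurable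
      moreover have "(\<exists>i. (a x, f i (a x)) \<in> ?R \<and> (f i (a x), b x) \<in> ?R ^^ n) \<longleftrightarrow> (a x, b x) \<in> ?R ^^ Suc n"
        if "x \<in> space M" for x
      proof
        assume "(a x, b x) \<in> ?R ^^ Suc n"
        then obtain y where y: "(a x, y) \<in> ?R" "(y, b x) \<in> ?R ^^ n" by (metis relpow_Suc_E2)
        then have "y \<in> (\<lambda>i. f i (a x)) ` UNIV" using f_range[OF measurable_space[OF ab(1) that]] by auto
        with y show "\<exists>i. (a x, f i (a x)) \<in> ?R \<and> (f i (a x), b x) \<in> ?R ^^ n" by auto
      qed (blast intro: relpow_Suc_I2)
      ultimately show "Measurable.pred M (\<lambda>x. (a x, b x) \<in> ?R ^^ Suc n)" by (simp cong: measurable_cong)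
    qed
  qed
  note rel = this
  show ?thesis unfolding borel2_def rtrancl_is_UN_relpow
  proof (intro ballI)
    fix a b assume ab: "a \<in> M \<rightarrow>\<^sub>M M" "b \<in> M \<rightarrow>\<^sub>M M"
    note borel2D[OF rel ab, measurable]
    have "Measurable.pred M (\<lambda>x. \<exists>n. (a x, b x) \<in> ?R ^^ n)" by measurable
    then show "Measurable.pred M (\<lambda>x. (a x, b x) \<in> (\<Union>n. ?R ^^ n))" by simp
  qed
qed

text \<open>A coloring of a finite component is coded by finitely many pairs of a word and a color, relative
  to the leader of the component; the colors are those of the first code that is proper.\<close>

lemma borel_coloring_finite_components:
  assumes sym: "sym \<Gamma>" and A: "A \<in> sets M"
    and fin: "\<And>x. x \<in> space M \<Longrightarrow> finite {y. (x, y) \<in> (\<Gamma> \<inter> A \<times> A)\<^sup>*}"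
    and c0: "\<And>x. x \<in> space M \<Longrightarrow> c0 x < k" "\<And>x y. (x, y) \<in> \<Gamma> \<Longrightarrow> c0 x \<noteq> (c0 y :: nat)"
  obtains c where "c \<in> M \<rightarrow>\<^sub>M count_space UNIV" "\<And>x. x \<in> space M \<Longrightarrow> c x < k"
    "\<And>x y. (x, y) \<in> \<Gamma> \<Longrightarrow> x \<in> A \<Longrightarrow> y \<in> A \<Longrightarrow> c x \<noteq> (c y :: nat)"
proof -
  let ?G = "\<Gamma> \<inter> A \<times> A"
  define R where "R x y \<longleftrightarrow> (x, y) \<in> ?G\<^sup>*" for x y
  have G_sub: "\<Gamma> \<subseteq> space M \<times> space M" using sets.sets_into_space[OF \<Gamma>_meas] by (simp add: space_pair_measure)
  have R: "borel2 R" using borel2_rtrancl[OF A] unfolding R_def .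
  have symG: "sym (?G\<^sup>*)" using sym by (intro sym_rtrancl) (auto simp: sym_def)
  have R_comp: "y \<in> range (\<lambda>w. g w x)" if "x \<in> space M" "R x y" for x y
  proof -
    from that(2) obtain n where "(x, y) \<in> ?G ^^ n" unfolding R_def by (metis rtrancl_imp_relpow)
    moreover have "?G ^^ n \<subseteq> \<Gamma> ^^ n" by (induction n) (simp_all add: relcomp_mono)
    ultimately have "(x, y) \<in> \<Gamma> ^^ n" by blast
    then show ?thesis using gball_comp[OF that(1), of n] by (auto simp: gball_def)
  qed
  obtain l where l: "l \<in> M \<rightarrow>\<^sub>M M" "\<And>x. x \<in> space M \<Longrightarrow> R x (l x)"
    "\<And>x y. x \<in> space M \<Longrightarrow> R x y \<Longrightarrow> l x = l y"
  proof (rule borel_leader[OF R R_comp])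
    show "R x z \<longleftrightarrow> R y z" if "R x y" for x y z
      using that symD[OF symG] unfolding R_def by (meson rtrancl_trans)
  qed (use fin R_def in auto)
  define valid where "valid z p \<longleftrightarrow> (\<forall>q\<in>set p. snd q < k) \<and>
      (\<forall>w. R z (g w z) \<longrightarrow> (\<exists>q\<in>set p. g (fst q) z = g w z)) \<and>
      (\<forall>q\<in>set p. \<forall>q'\<in>set p. (g (fst q) z, g (fst q') z) \<in> ?G \<longrightarrow> snd q \<noteq> snd q')"
    for z and p :: "(nat list \<times> nat) list"
  have G2: "borel2 (\<lambda>x y. (x, y) \<in> ?G)" using \<Gamma>_meas A by (intro borel2_set) auto
  note borel2D[OF R measurable_ident_sets[OF refl] g_meas, measurable]
    borel2D[OF borel2_eq g_meas g_meas, measurable] borel2D[OF G2 g_meas g_meas, measurable]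
  have valid_meas [measurable]: "Measurable.pred M (\<lambda>z. valid z p)" for p
    unfolding valid_def by measurable
  have ex_valid: "\<exists>p. valid z p" if z: "z \<in> space M" for z
  proof -
    obtain ys where ys: "set ys = {y. R z y}" using fin[OF z] finite_list unfolding R_def by blast
    have "\<forall>y\<in>set ys. \<exists>w. y = g w z" using R_comp[OF z] ys by auto
    then obtain w where w: "\<And>y. y \<in> set ys \<Longrightarrow> y = g (w y) z" by metis
    have "valid z (map (\<lambda>y. (w y, c0 y)) ys)"
      unfolding valid_def
    proof (intro conjI allI impI ballI)
      fix q assume "q \<in> set (map (\<lambda>y. (w y, c0 y)) ys)"
      then obtain y where y: "y \<in> set ys" "q = (w y, c0 y)" by auto
      then show "snd q < k" using w[OF y(1)] g_space[OF z] c0(1) by (metis snd_conv)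
      fix q' assume "q' \<in> set (map (\<lambda>y. (w y, c0 y)) ys)" "(g (fst q) z, g (fst q') z) \<in> ?G"
      then obtain y' where y': "y' \<in> set ys" "q' = (w y', c0 y')" "(g (fst q) z, g (fst q') z) \<in> ?G" by auto
      then have "(y, y') \<in> \<Gamma>" using y w[of y] w[of y'] by auto
      then show "snd q \<noteq> snd q'" using c0(2) y y' by simp
    next
      fix v assume "R z (g v z)"
      then have "g v z \<in> set ys" using ys by simp
      then show "\<exists>q\<in>set (map (\<lambda>y. (w y, c0 y)) ys). g (fst q) z = g v z"
        using w[of "g v z"] by (intro bexI[of _ "(w (g v z), c0 (g v z))"]) (simp_all only: fst_conv set_map, blast)
    qed
    then show ?thesis by blast
  qed
  define n where "n z = (LEAST n. valid z (from_nat n))" for z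
  have n_meas: "n \<in> M \<rightarrow>\<^sub>M count_space UNIV" unfolding n_def by measurable
  have n: "valid z (from_nat (n z))" if "z \<in> space M" for z
  proof -
    from ex_valid[OF that] obtain p where "valid z p" ..
    then have "valid z (from_nat (to_nat p))" by simp
    then show ?thesis unfolding n_def by (rule LeastI)
  qed
  \<comment> \<open>Several words may name \<open>x\<close> with different colors; the least of
    these is taken. Validity compares all namings of adjacent points, so the choice does no
    harm.\<close>
  define c where "c x = (LEAST c. \<exists>q\<in>set (from_nat (n (l x)) :: (nat list \<times> nat) list). snd q = c \<and> g (fst q) (l x) = x)" for x
  have c_meas: "c \<in> M \<rightarrow>\<^sub>M count_space UNIV" unfolding c_def
  proof (rule measurable_compose_countable[where f="\<lambda>m x. LEAST c. \<exists>q\<in>set (from_nat m :: (nat list \<times> nat) list). snd q = c \<and> g (fst q) (l x) = x" and g="\<lambda>x. n (l x)"])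
    show "(\<lambda>x. n (l x)) \<in> M \<rightarrow>\<^sub>M count_space UNIV" by (rule measurable_compose[OF l(1) n_meas])
    fix m
    note borel2D[OF borel2_eq measurable_compose[OF l(1) g_meas] measurable_ident_sets[OF refl], measurable]
    show "(\<lambda>x. LEAST c. \<exists>q\<in>set (from_nat m :: (nat list \<times> nat) list). snd q = c \<and> g (fst q) (l x) = x) \<in> M \<rightarrow>\<^sub>M count_space UNIV"
      by measurable
  qed
  have c: "\<exists>q\<in>set (from_nat (n (l x))). snd q = c x \<and> g (fst q) (l x) = x" if x: "x \<in> space M" for x
  proof -
    have lx: "l x \<in> space M" using measurable_space[OF l(1) x] .
    have Rlx: "R (l x) x" using l(2)[OF x] symD[OF symG] by (simp add: R_def)
    then obtain w where w: "x = g w (l x)" using R_comp[OF lx] by blast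
    have "\<forall>v. R (l x) (g v (l x)) \<longrightarrow> (\<exists>q\<in>set (from_nat (n (l x)) :: (nat list \<times> nat) list). g (fst q) (l x) = g v (l x))"
      using n[OF lx] unfolding valid_def by blast
    then have "\<exists>q\<in>set (from_nat (n (l x)) :: (nat list \<times> nat) list). g (fst q) (l x) = x"
      using Rlx w by metis
    then have "\<exists>c. \<exists>q\<in>set (from_nat (n (l x))). snd q = (c :: nat) \<and> g (fst q) (l x) = x" by blast
    then show ?thesis unfolding c_def by (rule LeastI_ex)
  qed
  show ?thesis
  proof (rule that[OF c_meas])
    fix x assume x: "x \<in> space M"
    then show "c x < k" using c[OF x] n[OF measurable_space[OF l(1) x]] unfolding valid_def by metis
  next
    fix x y assume xy: "(x, y) \<in> \<Gamma>" "x \<in> A" "y \<in> A"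
    then have xs: "x \<in> space M" "y \<in> space M" using G_sub by auto
    have "R x y" using xy unfolding R_def by blast
    then have ll: "l x = l y" using l(3) xs by blast
    obtain q where q: "q \<in> set (from_nat (n (l x)))" "snd q = c x" "g (fst q) (l x) = x" using c[OF xs(1)] by blast
    obtain q' where q': "q' \<in> set (from_nat (n (l x)))" "snd q' = c y" "g (fst q') (l x) = y" using c[OF xs(2)] ll by auto
    have "(g (fst q) (l x), g (fst q') (l x)) \<in> ?G" using q(3) q'(3) xy by simp
    then show "c x \<noteq> c y" using n[OF measurable_space[OF l(1) xs(1)]] q q' unfolding valid_def by metis
  qed
qed

text \<open>The color is the index of the first rational interval that contains the code of
  \<open>x\<close> and no code of a neighbour; it exists because the neighbours are finitely many.
  Adjacent points cannot choose the same interval.\<close>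

lemma borel_countable_coloring:
  assumes irrefl: "irrefl \<Gamma>" and fin: "\<And>x. x \<in> space M \<Longrightarrow> finite {y. (x, y) \<in> \<Gamma>}"
  obtains c where "c \<in> M \<rightarrow>\<^sub>M count_space UNIV" "\<And>x y. (x, y) \<in> \<Gamma> \<Longrightarrow> c x \<noteq> (c y :: nat)"
proof -
  have G_sub: "\<Gamma> \<subseteq> space M \<times> space M" using sets.sets_into_space[OF \<Gamma>_meas] by (simp add: space_pair_measure)
  define I where "I n = {real_of_rat (fst (from_nat n :: rat \<times> rat))<..<real_of_rat (snd (from_nat n :: rat \<times> rat))}" for n
  define c where "c x = (LEAST n. \<phi> x \<in> I n \<and> (\<forall>i. f i x \<noteq> x \<longrightarrow> \<phi> (f i x) \<notin> I n))" for x
  note f_meas[measurable] borel2D[OF borel2_eq f_meas measurable_ident_sets[OF refl], measurable]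
  have [measurable]: "I n \<in> sets borel" for n by (simp add: I_def)
  have "c \<in> M \<rightarrow>\<^sub>M count_space UNIV" unfolding c_def by measurable
  moreover have c: "\<phi> x \<in> I (c x) \<and> (\<forall>i. f i x \<noteq> x \<longrightarrow> \<phi> (f i x) \<notin> I (c x))" if x: "x \<in> space M" for x
  proof -
    let ?F = "\<phi> ` {y. (x, y) \<in> \<Gamma>}"
    have "\<phi> x \<notin> ?F"
    proof
      assume "\<phi> x \<in> ?F"
      then obtain y where y: "\<phi> x = \<phi> y" "(x, y) \<in> \<Gamma>" by blast
      then have "x = y" using \<phi>_inj x G_sub by (auto dest: inj_onD)
      with y irrefl show False by (auto simp: irrefl_def)
    qed
    moreover have "open (- ?F)" using fin[OF x] by (intro open_Compl finite_imp_closed) simp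
    ultimately obtain e where e: "e > 0" "ball (\<phi> x) e \<subseteq> - ?F" by (meson ComplI open_contains_ball)
    obtain a where a: "\<phi> x - e < real_of_rat a" "real_of_rat a < \<phi> x" using of_rat_dense[of "\<phi> x - e" "\<phi> x"] e by auto
    obtain b where b: "\<phi> x < real_of_rat b" "real_of_rat b < \<phi> x + e" using of_rat_dense[of "\<phi> x" "\<phi> x + e"] e by auto
    have "I (to_nat (a, b)) \<subseteq> ball (\<phi> x) e" using a b by (auto simp: I_def dist_real_def)
    moreover have "\<phi> (f i x) \<in> ?F" if "f i x \<noteq> x" for i using f_range[OF x] that by blast
    moreover have "\<phi> x \<in> I (to_nat (a, b))" using a b by (simp add: I_def)
    ultimately have "\<phi> x \<in> I (to_nat (a, b)) \<and> (\<forall>i. f i x \<noteq> x \<longrightarrow> \<phi> (f i x) \<notin> I (to_nat (a, b)))"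
      using e(2) by blast
    then show ?thesis unfolding c_def by (rule LeastI)
  qed
  moreover have "c x \<noteq> c y" if xy: "(x, y) \<in> \<Gamma>" for x y
  proof
    assume eq: "c x = c y"
    have xs: "x \<in> space M" "y \<in> space M" using xy G_sub by auto
    have "y \<noteq> x" using xy irrefl by (auto simp: irrefl_def)
    moreover have "y \<in> (\<lambda>i. f i x) ` UNIV" using f_range[OF xs(1)] xy by simp
    ultimately show False using c[OF xs(1)] c[OF xs(2)] eq by auto
  qed
  ultimately show ?thesis using that by blast
qed

end

section \<open>Measurability of cells and cores, and the merged coloring\<close>

locale borel_coarse_scales = borel_system M \<Gamma> f \<phi> + coarse_scales "space M" \<Gamma> E D q b
  for M :: "'a measure" and \<Gamma> f \<phi> E D q b +
  assumes E_meas: "E n \<in> sets (M \<Otimes>\<^sub>M M)"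
begin

lemma g_id: "(\<lambda>x. x) \<in> M \<rightarrow>\<^sub>M M"
  by simp

lemma borel2_E: "borel2 (\<lambda>x y. (x, y) \<in> E n)"
  by (rule borel2_set[OF E_meas])

lemma E_class_eq_iff:
  "x \<in> space M \<Longrightarrow> y \<in> space M \<Longrightarrow> E n `` {x} = E n `` {y} \<longleftrightarrow> (x, y) \<in> E n"
  using eq_equiv_class_iff[OF E_equiv] by metis

text \<open>Listing representatives of the classes as words turns a bound on a cardinality into
  quantifiers over countable sets.\<close>

lemma card_cls_le_iff:
  assumes x: "x \<in> space M" and A: "A \<subseteq> range (\<lambda>w. g w x)" "finite A"
  shows "card (cls n A) \<le> m \<longleftrightarrow>
    (\<exists>ws. length ws \<le> m \<and> (\<forall>w. g w x \<in> A \<longrightarrow> (\<exists>v\<in>set ws. (g v x, g w x) \<in> E n)))"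
proof
  assume le: "card (cls n A) \<le> m"
  obtain Cs where Cs: "set Cs = cls n A" "distinct Cs"
    using finite_distinct_list[OF cls_finite[OF A(2)]] by blast
  have "\<forall>Q\<in>set Cs. \<exists>v. Q = E n `` {g v x}"
    using A(1) unfolding Cs(1) cls_def by blast
  then obtain v where v: "\<And>Q. Q \<in> set Cs \<Longrightarrow> Q = E n `` {g (v Q) x}" by metis
  have "length (map v Cs) \<le> m" using le distinct_card[OF Cs(2)] Cs(1) by simp
  moreover have "\<exists>u\<in>set (map v Cs). (g u x, g w x) \<in> E n" if "g w x \<in> A" for w
  proof -
    have Q: "E n `` {g w x} \<in> set Cs" using that Cs(1) by (auto simp: cls_def)
    from v[OF this] have "(g (v (E n `` {g w x})) x, g w x) \<in> E n"
      using E_class_eq_iff[OF g_space[OF x] g_space[OF x]] by metis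
    then show ?thesis using Q by auto
  qed
  ultimately show "\<exists>ws. length ws \<le> m \<and> (\<forall>w. g w x \<in> A \<longrightarrow> (\<exists>v\<in>set ws. (g v x, g w x) \<in> E n))" by blast
next
  assume "\<exists>ws. length ws \<le> m \<and> (\<forall>w. g w x \<in> A \<longrightarrow> (\<exists>v\<in>set ws. (g v x, g w x) \<in> E n))"
  then obtain ws where ws: "length ws \<le> m" "\<And>w. g w x \<in> A \<Longrightarrow> \<exists>v\<in>set ws. (g v x, g w x) \<in> E n" by blast
  have sub: "cls n A \<subseteq> (\<lambda>v. E n `` {g v x}) ` set ws"
  proof
    fix Q assume "Q \<in> cls n A"
    then obtain w where w: "g w x \<in> A" "Q = E n `` {g w x}" using A(1) by (auto simp: cls_def)
    then obtain v where v: "v \<in> set ws" "(g v x, g w x) \<in> E n" using ws(2) by blast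
    then show "Q \<in> (\<lambda>v. E n `` {g v x}) ` set ws"
      using w E_class_eq_iff[OF g_space[OF x] g_space[OF x]] by blast
  qed
  have "card (cls n A) \<le> card (set ws)"
    using card_mono[OF _ sub] card_image_le[of "set ws"] by (meson finite_imageI finite_set le_trans)
  then show "card (cls n A) \<le> m" using ws(1) card_length[of ws] by linarith
qed

lemma card_cls_measurable:
  assumes A: "\<And>x. x \<in> space M \<Longrightarrow> A x \<subseteq> range (\<lambda>w. g w x)" "\<And>x. x \<in> space M \<Longrightarrow> finite (A x)"
    and [measurable]: "\<And>w. Measurable.pred M (\<lambda>x. g w x \<in> A x)"
  shows "(\<lambda>x. card (cls n (A x))) \<in> M \<rightarrow>\<^sub>M count_space UNIV"
proof (rule pred_measurable_nat_le)
  fix m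
  note borel2D[OF borel2_E g_meas g_meas, measurable]
  have "Measurable.pred M (\<lambda>x. \<exists>ws. length ws \<le> m \<and> (\<forall>w. g w x \<in> A x \<longrightarrow> (\<exists>v\<in>set ws. (g v x, g w x) \<in> E n)))"
    by (intro pred_intros_countable pred_intros_logic pred_intros_finite) measurable
  then show "Measurable.pred M (\<lambda>x. card (cls n (A x)) \<le> m)"
    using card_cls_le_iff[OF _ A] by (simp cong: measurable_cong)
qed

lemma borel2_gball: "borel2 (\<lambda>x y. y \<in> B x r)"
  unfolding borel2_def
proof (intro ballI)
  fix a b' assume ab: "a \<in> M \<rightarrow>\<^sub>M M" "b' \<in> M \<rightarrow>\<^sub>M M"
  note borel2D[OF borel2_eq measurable_compose[OF ab(1) g_meas] ab(2), measurable]
  have "Measurable.pred M (\<lambda>x. \<exists>w. length w = r \<and> g w (a x) = b' x)" by measurable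
  moreover have "(\<exists>w. length w = r \<and> g w (a x) = b' x) \<longleftrightarrow> b' x \<in> B (a x) r" if "x \<in> space M" for x
    unfolding gball_eq[OF measurable_space[OF ab(1) that]] mem_Collect_eq by metis
  ultimately show "Measurable.pred M (\<lambda>x. b' x \<in> B (a x) r)" by (simp cong: measurable_cong)
qed

lemma card_cls_gball_measurable: "(\<lambda>x. card (cls n (B x r))) \<in> M \<rightarrow>\<^sub>M count_space UNIV"
  using gball_comp B_finite borel2D[OF borel2_gball g_id g_meas] by (rule card_cls_measurable)

lemma class_index_meas: "class_index \<in> M \<rightarrow>\<^sub>M count_space UNIV"
proof -
  note measurable_compose[OF card_cls_gball_measurable, of "\<lambda>k. k \<le> m" "count_space UNIV" for m, measurable]
  show ?thesis unfolding class_index_def[abs_def] by measurable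
qed

lemma start_meas: "start \<in> M \<rightarrow>\<^sub>M count_space UNIV"
proof -
  note measurable_nat_rel[OF class_index_meas card_cls_gball_measurable, of "(\<le>)", measurable]
  show ?thesis unfolding start_def[abs_def] by measurable
qed

lemma borel2_cls_gball_eq: "borel2 (\<lambda>x y. cls n (B x r) = cls n (B y s))"
  unfolding borel2_def
proof (intro ballI)
  fix a b' assume ab: "a \<in> M \<rightarrow>\<^sub>M M" "b' \<in> M \<rightarrow>\<^sub>M M"
  note borel2D[OF borel2_E measurable_compose[OF ab(1) g_meas] measurable_compose[OF ab(2) g_meas], measurable]
  have "Measurable.pred M (\<lambda>x. (\<forall>v. length v = r \<longrightarrow> (\<exists>w. length w = s \<and> (g v (a x), g w (b' x)) \<in> E n)) \<and>
      (\<forall>w. length w = s \<longrightarrow> (\<exists>v. length v = r \<and> (g v (a x), g w (b' x)) \<in> E n)))" by measurable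
  moreover have "(\<forall>v. length v = r \<longrightarrow> (\<exists>w. length w = s \<and> (g v (a x), g w (b' x)) \<in> E n)) \<and>
      (\<forall>w. length w = s \<longrightarrow> (\<exists>v. length v = r \<and> (g v (a x), g w (b' x)) \<in> E n)) \<longleftrightarrow>
      cls n (B (a x) r) = cls n (B (b' x) s)" if x: "x \<in> space M" for x
  proof -
    have ax: "a x \<in> space M" "b' x \<in> space M" using ab measurable_space x by metis+
    have cls: "cls n (B y r) = (\<lambda>w. E n `` {g w y}) ` {w. length w = r}" if "y \<in> space M" for y r
      unfolding cls_def gball_eq[OF that] by auto
    have iff: "(g v (a x), g w (b' x)) \<in> E n \<longleftrightarrow> E n `` {g v (a x)} = E n `` {g w (b' x)}" for v w
      using E_class_eq_iff g_space ax by simp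
    have image_eq: "F ` S = F' ` T \<longleftrightarrow> (\<forall>v\<in>S. \<exists>w\<in>T. F v = F' w) \<and> (\<forall>w\<in>T. \<exists>v\<in>S. F v = F' w)"
      for F F' :: "nat list \<Rightarrow> 'a set" and S T
      unfolding set_eq_subset image_subset_iff image_iff by metis
    show ?thesis unfolding cls[OF ax(1)] cls[OF ax(2)] iff image_eq by simp
  qed
  ultimately show "Measurable.pred M (\<lambda>x. cls n (B (a x) r) = cls n (B (b' x) s))" by (simp cong: measurable_cong)
qed

text \<open>The radii depend on the points, but only through \<open>start\<close>, which takes
  countably many values; for fixed radii \<open>borel2_cls_gball_eq\<close> applies.\<close>

lemma borel2_trace_eq: "borel2 (\<lambda>x y. trace n x = trace n y)"
  unfolding borel2_def trace_def
proof (intro ballI)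
  fix a b' assume ab: "a \<in> M \<rightarrow>\<^sub>M M" "b' \<in> M \<rightarrow>\<^sub>M M"
  show "Measurable.pred M (\<lambda>x. cls n (B (a x) (radius (start (a x)))) = cls n (B (b' x) (radius (start (b' x)))))"
    by (rule measurable_compose_countable[where g="\<lambda>x. start (a x)" and
        f="\<lambda>i x. cls n (B (a x) (radius i)) = cls n (B (b' x) (radius (start (b' x))))"],
        rule measurable_compose_countable[where g="\<lambda>x. start (b' x)" and
        f="\<lambda>j x. cls n (B (a x) (radius _)) = cls n (B (b' x) (radius j))"])
      (intro borel2D[OF borel2_cls_gball_eq ab] measurable_compose[OF ab(1) start_meas] measurable_compose[OF ab(2) start_meas])+
qed

lemma borel2_cell: "borel2 (\<lambda>x y. y \<in> cell n x)"
  unfolding borel2_def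
proof (intro ballI)
  fix a b' assume ab: "a \<in> M \<rightarrow>\<^sub>M M" "b' \<in> M \<rightarrow>\<^sub>M M"
  have "b' x \<in> cell n (a x) \<longleftrightarrow> trace n (b' x) = trace n (a x)" if "x \<in> space M" for x
    using measurable_space[OF ab(2) that] by (simp add: cell_def)
  then show "Measurable.pred M (\<lambda>x. b' x \<in> cell n (a x))"
    using borel2D[OF borel2_trace_eq ab(2,1)] by (simp cong: measurable_cong)
qed

lemma cell_comp: "x \<in> space M \<Longrightarrow> cell n x \<subseteq> range (\<lambda>w. g w x)"
  using cell_bounded gball_comp by (meson subset_trans)

lemma cell_nbhd_comp: "x \<in> space M \<Longrightarrow> cell_nbhd x i \<subseteq> range (\<lambda>w. g w x)"
  using cell_nbhd_bounded gball_comp by (meson subset_trans)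

lemma cell_nbhd_pred: "Measurable.pred M (\<lambda>x. g w x \<in> cell_nbhd x i)"
proof -
  note borel2D[OF borel2_cell g_id g_meas, measurable] borel2D[OF borel2_gball g_meas g_meas, measurable]
  have "Measurable.pred M (\<lambda>x. \<exists>v. g v x \<in> cell i x \<and> g w x \<in> B (g v x) (shift i + radius (Suc i)))"
    by measurable
  moreover have "(\<exists>v. g v x \<in> cell i x \<and> g w x \<in> B (g v x) (shift i + radius (Suc i))) \<longleftrightarrow> g w x \<in> cell_nbhd x i"
    if "x \<in> space M" for x
    using cell_comp[OF that] unfolding cell_nbhd_def by blast
  ultimately show ?thesis by (simp cong: measurable_cong)
qed

lemma absorb_time_meas: "(\<lambda>x. absorb_time x i) \<in> M \<rightarrow>\<^sub>M count_space UNIV"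
proof -
  note measurable_nat_rel[OF card_cls_measurable[OF cell_nbhd_comp cell_nbhd_finite cell_nbhd_pred] class_index_meas, of "(\<le>)", measurable]
  show ?thesis unfolding absorb_time_def by measurable
qed

lemma key_level_pred: "Measurable.pred M (\<lambda>x. key_level x i)"
  unfolding key_level_def by (rule measurable_nat_rel[OF absorb_time_meas absorb_time_meas])

lemma key_count_meas: "(\<lambda>x. key_count x u v) \<in> M \<rightarrow>\<^sub>M count_space UNIV"
  unfolding key_count_def by (rule pred_card_measurable[OF key_level_pred])

lemma gball_subset_cell_pred: "Measurable.pred M (\<lambda>x. B x r \<subseteq> cell v x)"
proof -
  note borel2D[OF borel2_cell g_id g_meas, measurable]
  have "Measurable.pred M (\<lambda>x. \<forall>w. length w = r \<longrightarrow> g w x \<in> cell v x)" by measurable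
  moreover have "(\<forall>w. length w = r \<longrightarrow> g w x \<in> cell v x) \<longleftrightarrow> B x r \<subseteq> cell v x" if "x \<in> space M" for x
    using gball_eq[OF that, of r] by auto
  ultimately show ?thesis by (simp cong: measurable_cong)
qed

lemma deep_pred: "Measurable.pred M (\<lambda>x. deep x u)"
proof -
  have [measurable]: "Measurable.pred M (\<lambda>x. B x (4 * (key_count x u v + 1)) \<subseteq> cell v x)" for v
    by (rule measurable_compose_countable[where f="\<lambda>k x. B x (4 * (k + 1)) \<subseteq> cell v x", OF gball_subset_cell_pred key_count_meas])
  note key_level_pred[measurable]
  show ?thesis unfolding deep_def by measurable
qed

lemma core_boundary_pred: "Measurable.pred M core_boundary"
proof -
  note deep_pred[measurable] measurable_compose[OF g_meas deep_pred, measurable]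
    borel2D[OF borel2_cell g_id g_meas, measurable]
  have "Measurable.pred M (\<lambda>x. \<exists>u. deep x u \<and> (\<exists>w. length w = 1 \<and> \<not> (g w x \<in> cell u x \<and> deep (g w x) u)))"
    by measurable
  moreover have "(\<exists>u. deep x u \<and> (\<exists>w. length w = 1 \<and> \<not> (g w x \<in> cell u x \<and> deep (g w x) u))) \<longleftrightarrow> core_boundary x"
    if "x \<in> space M" for x
    using gball_eq[OF that, of 1] unfolding core_boundary_def core_def by auto
  ultimately show ?thesis by (rule measurable_cong[THEN iffD1, rotated])
qed

text \<open>Two Borel \<open>k\<close>-colorings, one near \<^term>\<open>core_boundary\<close> and one outside of it, are merged. They share
  only the color 0, and a point outside \<^term>\<open>core_boundary\<close> of color 0 next to \<^term>\<open>core_boundary\<close> is recolored by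
  the first coloring.\<close>

lemma borel_coloring_2k1:
  assumes c0: "\<And>x. x \<in> space M \<Longrightarrow> c0 x < k" "\<And>x y. (x, y) \<in> \<Gamma> \<Longrightarrow> c0 x \<noteq> (c0 y :: nat)"
  obtains c where "c \<in> M \<rightarrow>\<^sub>M count_space UNIV" "\<And>x. x \<in> space M \<Longrightarrow> c x < 2 * k - 1"
    "\<And>x y. (x, y) \<in> \<Gamma> \<Longrightarrow> c x \<noteq> (c y :: nat)"
proof -
  \<comment> \<open>The sets \<open>A\<close> and \<open>A'\<close> overlap in the points next to
    the boundary, where both colorings are proper and recoloring is possible.\<close>
  define A where "A = {x \<in> space M. \<exists>z\<in>B x 1. core_boundary z}"
  define A' where "A' = {x \<in> space M. \<not> core_boundary x}"
  note core_boundary_pred[measurable] measurable_compose[OF g_meas core_boundary_pred, measurable]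
  have A'_meas [measurable]: "A' \<in> sets M" unfolding A'_def by measurable
  have "Measurable.pred M (\<lambda>x. \<exists>w. length w = 1 \<and> core_boundary (g w x))" by measurable
  moreover have "(\<exists>w. length w = 1 \<and> core_boundary (g w x)) \<longleftrightarrow> (\<exists>z\<in>B x 1. core_boundary z)" if "x \<in> space M" for x
    using gball_eq[OF that, of 1] by auto
  ultimately have "Measurable.pred M (\<lambda>x. \<exists>z\<in>B x 1. core_boundary z)" by (rule measurable_cong[THEN iffD1, rotated])
  then have A_meas [measurable]: "A \<in> sets M" by (simp add: A_def pred_def)
  have finA: "finite {y. (x, y) \<in> (\<Gamma> \<inter> A \<times> A)\<^sup>*}" if "x \<in> space M" for x
  proof (cases "x \<in> A")
    case True
    then show ?thesis by (rule finite_component_near_core_boundary) (auto simp: A_def)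
  next
    case False
    then have "{y. (x, y) \<in> (\<Gamma> \<inter> A \<times> A)\<^sup>*} \<subseteq> {x}" by (auto elim: converse_rtranclE)
    then show ?thesis by (rule finite_subset) simp
  qed
  obtain c1 where c1: "c1 \<in> M \<rightarrow>\<^sub>M count_space UNIV" "\<And>x. x \<in> space M \<Longrightarrow> c1 x < k"
    "\<And>x y. (x, y) \<in> \<Gamma> \<Longrightarrow> x \<in> A \<Longrightarrow> y \<in> A \<Longrightarrow> c1 x \<noteq> (c1 y :: nat)"
  proof (rule borel_coloring_finite_components[OF sym_\<Gamma> A_meas, of c0 k])
  qed (use finA c0 that in blast)+
  have finA': "finite {y. (x, y) \<in> (\<Gamma> \<inter> A' \<times> A')\<^sup>*}" if "x \<in> space M" for x
    using that by (rule finite_component_outside_core_boundary) (auto simp: A'_def)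
  obtain c2 where c2: "c2 \<in> M \<rightarrow>\<^sub>M count_space UNIV" "\<And>x. x \<in> space M \<Longrightarrow> c2 x < k"
    "\<And>x y. (x, y) \<in> \<Gamma> \<Longrightarrow> x \<in> A' \<Longrightarrow> y \<in> A' \<Longrightarrow> c2 x \<noteq> (c2 y :: nat)"
  proof (rule borel_coloring_finite_components[OF sym_\<Gamma> A'_meas, of c0 k])
  qed (use finA' c0 that in blast)+
  \<comment> \<open>Values of \<open>c1\<close> stay below \<open>k\<close>, and nonzero values of
    \<open>c2\<close> move to the range from \<open>k\<close> to \<open>2 * k - 2\<close>. A point
    left with color 0 outside \<open>A\<close> has no neighbour in the boundary, and its other
    neighbours have nonzero \<open>c2\<close>.\<close>
  define c where "c x = (if core_boundary x then c1 x else if c2 x = 0 then (if x \<in> A then c1 x else 0) else k - 1 + c2 x)" for x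
  note c1(1)[measurable] c2(1)[measurable]
  have "c \<in> M \<rightarrow>\<^sub>M count_space UNIV" unfolding c_def by measurable
  moreover have "c x < 2 * k - 1" if "x \<in> space M" for x
    using c1(2)[OF that] c2(2)[OF that] by (auto simp: c_def)
  moreover have "c x \<noteq> c y" if xy: "(x, y) \<in> \<Gamma>" for x y
  proof -
    have xs: "x \<in> space M" "y \<in> space M" using xy \<Gamma>_sub by auto
    have yx: "(y, x) \<in> \<Gamma>" using xy sym_\<Gamma> by (auto dest: symD)
    have near: "y \<in> A" if "core_boundary x" using that yx xs by (auto simp: A_def gball_1)
    have near': "x \<in> A" if "core_boundary y" using that xy xs by (auto simp: A_def gball_1)
    have self: "x \<in> A" if "core_boundary x" using that xs unfolding A_def by (auto intro: bexI[of _ x])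
    have self': "y \<in> A" if "core_boundary y" using that xs unfolding A_def by (auto intro: bexI[of _ y])
    have "c1 x < k" "c1 y < k" "c2 x < k" "c2 y < k" using c1(2) c2(2) xs by auto
    moreover have "x \<in> A \<Longrightarrow> y \<in> A \<Longrightarrow> c1 x \<noteq> c1 y" using c1(3)[OF xy] .
    moreover have "\<not> core_boundary x \<Longrightarrow> \<not> core_boundary y \<Longrightarrow> c2 x \<noteq> c2 y" using c2(3)[OF xy] xs by (auto simp: A'_def)
    ultimately show ?thesis using near near' self self'
      by (cases "core_boundary x"; cases "core_boundary y") (auto simp: c_def split: if_splits)
  qed
  ultimately show ?thesis using that by blast
qed

end

section \<open>From finite Borel asymptotic dimension to nested coarse scales\<close>

lemma graph_metric_le_iff: "graph_metric \<Gamma> x y \<le> of_nat r \<longleftrightarrow> y \<in> gball \<Gamma> x r"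
proof
  assume "y \<in> gball \<Gamma> x r"
  then obtain n where "n \<le> r" "(x, y) \<in> \<Gamma> ^^ n" by (auto simp: gball_def)
  then show "graph_metric \<Gamma> x y \<le> of_nat r"
    unfolding graph_metric_def by (intro INF_lower2[of n]) auto
next
  assume le: "graph_metric \<Gamma> x y \<le> of_nat r"
  show "y \<in> gball \<Gamma> x r"
  proof (rule ccontr)
    assume "y \<notin> gball \<Gamma> x r"
    then have "Suc r \<le> n" if "(x, y) \<in> \<Gamma> ^^ n" for n
      using that by (auto simp: gball_def not_less_eq_eq)
    then have "of_nat (Suc r) \<le> graph_metric \<Gamma> x y"
      unfolding graph_metric_def by (intro INF_greatest) (auto simp del: of_nat_Suc)
    with le have "of_nat (Suc r) \<le> (of_nat r :: ennreal)" by (rule order_trans[rotated])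
    then show False by (simp del: of_nat_Suc)
  qed
qed

lemma borel_asdim_finiteD:
  assumes "borel_asdim M \<rho> < \<infinity>"
  shows "\<exists>d. borel_asdim_le M \<rho> d"
proof (rule ccontr)
  assume "\<not> ?thesis"
  then have "borel_asdim M \<rho> = \<infinity>" by (simp add: borel_asdim_def top_enat_def)
  with assms show False by simp
qed

lemma borel_asdim_le_partition:
  assumes "borel_asdim_le M (graph_metric \<Gamma>) d" and \<Gamma>: "\<Gamma> \<subseteq> space M \<times> space M"
  shows "\<exists>G D. equiv (space M) G \<and> G \<in> sets (M \<Otimes>\<^sub>M M) \<and> (\<forall>x y. (x, y) \<in> G \<longrightarrow> y \<in> gball \<Gamma> x D) \<and>
    (\<forall>x\<in>space M. card ((\<lambda>y. G `` {y}) ` gball \<Gamma> x r) \<le> d + 1)"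
proof -
  \<comment> \<open>The definition needs a positive radius, while \<open>r\<close> may be 0.\<close>
  have "real (Suc r) > 0" by simp
  with assms(1) obtain G D where G: "borel_equiv M G" "D < \<infinity>"
    "\<And>C. C \<in> space M // G \<Longrightarrow> ext_diameter (graph_metric \<Gamma>) C \<le> D"
    "\<And>x. x \<in> space M \<Longrightarrow> let meets = {C \<in> space M // G. C \<inter> {y \<in> space M. graph_metric \<Gamma> x y \<le> ennreal (real (Suc r))} \<noteq> {}}
               in finite meets \<and> card meets \<le> d + 1"
    unfolding borel_asdim_le_def by meson
  have eq: "equiv (space M) G" and meas: "G \<in> sets (M \<Otimes>\<^sub>M M)" using G(1) by (auto simp: borel_equiv_def)
  obtain N where N: "D < of_nat N" using ennreal_Ex_less_of_nat G(2) by (auto simp: infinity_ennreal_def)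
  have "y \<in> gball \<Gamma> x N" if xy: "(x, y) \<in> G" for x y
  proof -
    have x: "x \<in> space M" using eq xy by (auto simp: equiv_def refl_on_def)
    have "(x, x) \<in> G" using eq x by (simp add: equiv_def refl_on_def)
    then have "graph_metric \<Gamma> x y \<le> ext_diameter (graph_metric \<Gamma>) (G `` {x})"
      unfolding ext_diameter_def using xy by (intro SUP_upper2[of "(x, y)"]) auto
    also have "\<dots> \<le> D" using x by (intro G(3)) (auto intro: quotientI)
    also have "\<dots> \<le> of_nat N" using N by simp
    finally show ?thesis by (simp add: graph_metric_le_iff)
  qed
  moreover have "card ((\<lambda>y. G `` {y}) ` gball \<Gamma> x r) \<le> d + 1" if x: "x \<in> space M" for x
  proof -
    let ?meets = "{C \<in> space M // G. C \<inter> {y \<in> space M. graph_metric \<Gamma> x y \<le> ennreal (real (Suc r))} \<noteq> {}}"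
    have sub: "(\<lambda>y. G `` {y}) ` gball \<Gamma> x r \<subseteq> ?meets"
    proof (rule image_subsetI)
      fix y assume y: "y \<in> gball \<Gamma> x r"
      then have yX: "y \<in> space M" using gball_subset_carrier[OF \<Gamma> x] by blast
      have "y \<in> gball \<Gamma> x (Suc r)" using y gball_mono[of r "Suc r" \<Gamma> x] by auto
      then have "graph_metric \<Gamma> x y \<le> ennreal (real (Suc r))"
        by (simp only: graph_metric_le_iff[symmetric] ennreal_of_nat_eq_real_of_nat)
      moreover have "y \<in> G `` {y}" using eq yX by (simp add: equiv_def refl_on_def)
      ultimately show "G `` {y} \<in> ?meets" using yX by (blast intro: quotientI)
    qed
    have "finite ?meets" "card ?meets \<le> d + 1" using G(4)[OF x] by (simp_all add: Let_def)
    then show ?thesis using card_mono[OF _ sub] by (meson le_trans)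
  qed
  ultimately show ?thesis using eq meas by blast
qed

text \<open>The relations given by the dimension need not be nested. Pulling back the next one along
  the leader map of the current one makes it coarser, adds only bounded amounts to the diameter, and
  keeps the multiplicity at most \<open>d + 1\<close>.\<close>

lemma (in borel_system) ex_coarse_scales:
  assumes sym: "sym \<Gamma>" and fin: "\<And>x. x \<in> space M \<Longrightarrow> finite {y. (x, y) \<in> \<Gamma>}"
    and asdim: "borel_asdim_le M (graph_metric \<Gamma>) d"
  shows "\<exists>E D q. borel_coarse_scales M \<Gamma> f \<phi> E D q (d + 1)"
proof -
  have \<Gamma>_sub: "\<Gamma> \<subseteq> space M \<times> space M" using sets.sets_into_space[OF \<Gamma>_meas] by (simp add: space_pair_measure)
  have ball_fin: "finite (gball \<Gamma> x r)" if "x \<in> space M" for x r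
    using that by (rule gball_finite[OF \<Gamma>_sub, rotated]) (rule fin)
  define good where "good E D \<longleftrightarrow> equiv (space M) E \<and> E \<in> sets (M \<Otimes>\<^sub>M M) \<and>
    (\<forall>x y. (x, y) \<in> E \<longrightarrow> y \<in> gball \<Gamma> x D)" for E and D :: nat
  define mult where "mult E r \<longleftrightarrow> (\<forall>x\<in>space M. card ((\<lambda>y. E `` {y}) ` gball \<Gamma> x r) \<le> d + 1)" for E :: "('a \<times> 'a) set" and r :: nat
  have step: "\<exists>E' D'. good E' D' \<and> E \<subseteq> E' \<and> D \<le> D' \<and> mult E' r" if E: "good E D" for E D r
  proof -
    have eqE: "equiv (space M) E" and E_meas: "E \<in> sets (M \<Otimes>\<^sub>M M)"
      and E_bd: "\<And>x y. (x, y) \<in> E \<Longrightarrow> y \<in> gball \<Gamma> x D" using E by (auto simp: good_def)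
    have symE: "sym E" and reflE: "\<And>x. x \<in> space M \<Longrightarrow> (x, x) \<in> E" and transE: "trans E"
      using eqE by (auto simp: equiv_def refl_on_def)
    obtain l where l: "l \<in> M \<rightarrow>\<^sub>M M" "\<And>x. x \<in> space M \<Longrightarrow> (x, l x) \<in> E"
      "\<And>x y. x \<in> space M \<Longrightarrow> (x, y) \<in> E \<Longrightarrow> l x = l y"
    proof (rule borel_leader[OF borel2_set[OF E_meas]])
      show "y \<in> range (\<lambda>w. g w x)" if "x \<in> space M" "(x, y) \<in> E" for x y
        using gball_comp[OF that(1)] E_bd[OF that(2)] by blast
      show "finite {y. (x, y) \<in> E}" if "x \<in> space M" for x
        by (rule finite_subset[OF _ ball_fin[OF that, of D]]) (use E_bd in auto)
      show "(x, z) \<in> E \<longleftrightarrow> (y, z) \<in> E" if "(x, y) \<in> E" for x y z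
        using that symE transE by (meson symD transD)
    qed (use reflE in auto)
    \<comment> \<open>The additional \<open>D\<close> in the radius pays for moving the points of
      the ball to their leaders.\<close>
    obtain G D' where G: "equiv (space M) G" "G \<in> sets (M \<Otimes>\<^sub>M M)" "\<And>x y. (x, y) \<in> G \<Longrightarrow> y \<in> gball \<Gamma> x D'"
      "\<And>x. x \<in> space M \<Longrightarrow> card ((\<lambda>y. G `` {y}) ` gball \<Gamma> x (r + D)) \<le> d + 1"
      using borel_asdim_le_partition[OF asdim \<Gamma>_sub, of "r + D"] by blast
    have lX: "l x \<in> space M" if "x \<in> space M" for x using measurable_space[OF l(1) that] .
    define E' where "E' = {p \<in> space (M \<Otimes>\<^sub>M M). (l (fst p), l (snd p)) \<in> G}"
    have E': "(x, y) \<in> E' \<longleftrightarrow> x \<in> space M \<and> y \<in> space M \<and> (l x, l y) \<in> G" for x y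
      by (auto simp: E'_def space_pair_measure)
    have "equiv (space M) E'"
    proof (rule equivI)
      show "E' \<subseteq> space M \<times> space M" by (auto simp: E')
      show "refl_on (space M) E'" using G(1) lX by (auto simp: refl_on_def E' equiv_def)
      show "sym E'" using G(1) by (auto simp: sym_def E' equiv_def)
      show "trans E'" using G(1) unfolding trans_def E' equiv_def by blast
    qed
    moreover have "E' \<in> sets (M \<Otimes>\<^sub>M M)"
    proof -
      have "(\<lambda>p. (l (fst p), l (snd p))) \<in> M \<Otimes>\<^sub>M M \<rightarrow>\<^sub>M M \<Otimes>\<^sub>M M"
        by (intro measurable_Pair measurable_compose[OF measurable_fst l(1)] measurable_compose[OF measurable_snd l(1)])
      from measurable_sets[OF this G(2)] show ?thesis by (simp add: E'_def vimage_def Int_def conj_commute)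
    qed
    moreover have "y \<in> gball \<Gamma> x (D + D' + D)" if "(x, y) \<in> E'" for x y
    proof -
      have xy: "x \<in> space M" "y \<in> space M" "(l x, l y) \<in> G" using that by (auto simp: E')
      have "y \<in> gball \<Gamma> (l y) D" using E_bd l(2)[OF xy(2)] symE by (meson symD)
      then show ?thesis using gball_trans[OF gball_trans[OF E_bd[OF l(2)[OF xy(1)]] G(3)[OF xy(3)]]] by blast
    qed
    moreover have "E \<subseteq> E'"
    proof (rule subrelI)
      fix x y assume xy: "(x, y) \<in> E"
      then have xs: "x \<in> space M" "y \<in> space M" using eqE by (auto simp: equiv_def refl_on_def)
      then have "(l x, l x) \<in> G" using G(1) lX by (auto simp: equiv_def refl_on_def)
      then show "(x, y) \<in> E'" using l(3)[OF xs(1) xy] xs by (simp add: E')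
    qed
    moreover have "mult E' r" unfolding mult_def
    proof
      fix x assume x: "x \<in> space M"
      have ball: "gball \<Gamma> x r \<subseteq> space M" by (rule gball_subset_carrier[OF \<Gamma>_sub x])
      have "(\<lambda>y. E' `` {y}) ` gball \<Gamma> x r = (\<lambda>C. {z \<in> space M. l z \<in> C}) ` (\<lambda>y. G `` {l y}) ` gball \<Gamma> x r"
        unfolding image_image using ball by (intro image_cong) (auto simp: E')
      then have "card ((\<lambda>y. E' `` {y}) ` gball \<Gamma> x r) \<le> card ((\<lambda>y. G `` {l y}) ` gball \<Gamma> x r)"
        using ball_fin[OF x] by (simp add: card_image_le)
      also have "(\<lambda>y. G `` {l y}) ` gball \<Gamma> x r \<subseteq> (\<lambda>y. G `` {y}) ` gball \<Gamma> x (r + D)"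
        using ball E_bd l(2) gball_trans[of _ \<Gamma> x r _ D] by blast
      then have "card ((\<lambda>y. G `` {l y}) ` gball \<Gamma> x r) \<le> card ((\<lambda>y. G `` {y}) ` gball \<Gamma> x (r + D))"
        by (intro card_mono finite_imageI ball_fin[OF x])
      also have "\<dots> \<le> d + 1" by (rule G(4)[OF x])
      finally show "card ((\<lambda>y. E' `` {y}) ` gball \<Gamma> x r) \<le> d + 1" .
    qed
    ultimately show ?thesis unfolding good_def by (intro exI[of _ E'] exI[of _ "D + D' + D"]) auto
  qed
  define next_q where "next_q n D = D + 2 * radius n + shift n" for n D :: nat
  have "\<exists>F. \<forall>n. (good (fst (F n)) (snd (F n))) \<and> (fst (F n) \<subseteq> fst (F (Suc n)) \<and> snd (F n) \<le> snd (F (Suc n)) \<and>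
      mult (fst (F (Suc n))) (next_q (Suc n) (snd (F n))))"
  proof (rule dependent_nat_choice)
    have "\<exists>E D. good E D"
      using borel_asdim_le_partition[OF asdim \<Gamma>_sub, of 0] unfolding good_def by blast
    then show "\<exists>F. good (fst F) (snd F)" by (metis fst_conv snd_conv)
    show "\<exists>F'. good (fst F') (snd F') \<and> fst F \<subseteq> fst F' \<and> snd F \<le> snd F' \<and> mult (fst F') (next_q (Suc n) (snd F))"
      if "good (fst F) (snd F)" for F n
      using step[OF that] by (metis fst_conv snd_conv)
  qed
  then obtain F where F: "\<And>n. good (fst (F n)) (snd (F n))" "\<And>n. fst (F n) \<subseteq> fst (F (Suc n))"
    "\<And>n. snd (F n) \<le> snd (F (Suc n))" "\<And>n. mult (fst (F (Suc n))) (next_q (Suc n) (snd (F n)))" by blast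
  define E where "E n = fst (F n)" for n
  define D where "D n = snd (F n)" for n
  \<comment> \<open>At scale 0 the ball is a single point, so no multiplicity has to be arranged.
    Later values use \<open>D\<close> of the preceding scale, which by monotonicity covers all
    earlier ones.\<close>
  define q where "q n = (case n of 0 \<Rightarrow> 0 | Suc m \<Rightarrow> next_q n (D m))" for n
  have D_mono: "i \<le> j \<Longrightarrow> D i \<le> D j" for i j
    unfolding D_def using F(3) by (rule lift_Suc_mono_le)
  have "borel_coarse_scales M \<Gamma> f \<phi> E D q (d + 1)"
  proof unfold_locales
    show "card ((\<lambda>y. E n `` {y}) ` gball \<Gamma> x (q n)) \<le> d + 1" if "x \<in> space M" for x n
    proof (cases n)
      case 0
      then have "gball \<Gamma> x (q n) = {x}" by (auto simp: q_def gball_def)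
      then show ?thesis by simp
    next
      case (Suc m)
      then show ?thesis using F(4)[of m] that by (simp add: mult_def E_def q_def D_def)
    qed
    show "D i + 2 * radius n + shift n \<le> q n" if "i < n" for i n
      using that D_mono[of i "n - 1"] by (cases n) (auto simp: q_def next_q_def)
  qed (use F sym fin \<Gamma>_sub in \<open>auto simp: good_def E_def D_def\<close>)
  then show ?thesis by blast
qed

section \<open>The bound on the Borel chromatic number\<close>

lemma standard_borel_count_space:
  assumes "countable A"
  shows "standard_borel (count_space A)"
  unfolding standard_borel_def
proof (intro exI[of _ "discrete_topology A"] conjI)
  show "completely_metrizable_space (discrete_topology A)" by (rule completely_metrizable_space_discrete_topology)
  show "separable_space (discrete_topology A)" using assms by (simp add: separable_space_discrete_topology)
  show "sets (count_space A) = sigma_sets (space (count_space A)) {U. openin (discrete_topology A) U}"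
    by (auto intro: sigma_sets.Basic dest: sigma_sets_into_sp[rotated])
qed auto

theorem theorem1p6:
  fixes M :: "'a measure" and \<Gamma> :: "('a \<times> 'a) set"
  assumes "standard_borel M"
    and "borel_graph M \<Gamma>"
    and "locally_finite_graph (space M) \<Gamma>"
    and "borel_asdim M (graph_metric \<Gamma>) < \<infinity>"
  shows "if finite (Field (chromatic_number (space M) \<Gamma>))
    then borel_chromatic_number M \<Gamma> \<le>o |{..< 2 * card (Field (chromatic_number (space M) \<Gamma>)) - 1}|
    else borel_chromatic_number M \<Gamma> \<le>o chromatic_number (space M) \<Gamma>"
proof -
  have \<Gamma>: "\<Gamma> \<in> sets (M \<Otimes>\<^sub>M M)" "sym \<Gamma>" "irrefl \<Gamma>" using assms(2) by (auto simp: borel_graph_def)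
  have \<Gamma>_sub: "\<Gamma> \<subseteq> space M \<times> space M" using sets.sets_into_space[OF \<Gamma>(1)] by (simp add: space_pair_measure)
  have fin: "finite {y. (x, y) \<in> \<Gamma>}" if "x \<in> space M" for x
    using assms(3) that by (simp add: locally_finite_graph_def)
  obtain f where f: "\<And>i. f i \<in> M \<rightarrow>\<^sub>M M"
    "\<And>x. x \<in> space M \<Longrightarrow> (\<lambda>i::nat. f i x) ` UNIV = insert x {y. (x, y) \<in> \<Gamma>}"
    using finite_sections_enumeration[OF assms(1) \<Gamma>(1) fin] by blast
  obtain \<phi> :: "'a \<Rightarrow> real" where \<phi>: "\<phi> \<in> borel_measurable M" "inj_on \<phi> (space M)"
    using standard_borel_real_embedding[OF assms(1)] by blast
  interpret borel_system M \<Gamma> f \<phi>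
    by unfold_locales (use f \<phi> \<Gamma> in auto)
  obtain Z c where Z: "chromatic_number (space M) \<Gamma> = |Z|" "proper_coloring (space M) \<Gamma> Z c"
    using chromatic_number_attained[OF \<Gamma>_sub \<Gamma>(3)] by blast
  have le: "borel_chromatic_number M \<Gamma> \<le>o |A|"
    if "e \<in> M \<rightarrow>\<^sub>M count_space UNIV" "\<And>x. x \<in> space M \<Longrightarrow> e x \<in> A" "\<And>x y. (x, y) \<in> \<Gamma> \<Longrightarrow> e x \<noteq> e y"
    for e :: "'a \<Rightarrow> nat" and A
  proof -
    have "e \<in> M \<rightarrow>\<^sub>M count_space A"
      using that(1,2) by (auto simp: measurable_count_space_eq2_countable)
    moreover have "proper_coloring (space M) \<Gamma> (space (count_space A)) e"
      using that(2,3) by (auto simp: proper_coloring_def)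
    ultimately show ?thesis
      using borel_chromatic_number_le[OF assms(1) \<Gamma>_sub standard_borel_count_space[of A]] by auto
  qed
  show ?thesis
  proof (cases "finite Z")
    case True
    obtain t where t: "bij_betw t Z {0..<card Z}" using ex_bij_betw_finite_nat[OF True] by blast
    have c: "c x \<in> Z" if "x \<in> space M" for x using Z(2) that by (auto simp: proper_coloring_def)
    obtain d where d: "borel_asdim_le M (graph_metric \<Gamma>) d" using borel_asdim_finiteD[OF assms(4)] by blast
    obtain E D q where "borel_coarse_scales M \<Gamma> f \<phi> E D q (d + 1)"
      using ex_coarse_scales[OF \<Gamma>(2) fin d] by blast
    then interpret borel_coarse_scales M \<Gamma> f \<phi> E D q "d + 1" .
    have "t (c x) < card Z" if "x \<in> space M" for x
      using bij_betwE[OF t] c[OF that] by auto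
    moreover have "t (c x) \<noteq> t (c y)" if "(x, y) \<in> \<Gamma>" for x y
    proof -
      have "c x \<noteq> c y" "c x \<in> Z" "c y \<in> Z" using Z(2) c that \<Gamma>_sub by (auto simp: proper_coloring_def)
      then show ?thesis using bij_betw_imp_inj_on[OF t] by (auto dest: inj_onD)
    qed
    ultimately obtain e where "e \<in> M \<rightarrow>\<^sub>M count_space UNIV" "\<And>x. x \<in> space M \<Longrightarrow> e x < 2 * card Z - 1"
      "\<And>x y. (x, y) \<in> \<Gamma> \<Longrightarrow> e x \<noteq> e y"
      using borel_coloring_2k1[of "\<lambda>x. t (c x)" "card Z"] by blast
    then have "borel_chromatic_number M \<Gamma> \<le>o |{..<2 * card Z - 1}|" by (intro le) auto
    then show ?thesis using True by (simp add: Z(1) Field_card_of)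
  next
    case False
    \<comment> \<open>Local finiteness already gives a Borel coloring with countably many colors,
      and an infinite chromatic number is at least countable.\<close>
    obtain e :: "'a \<Rightarrow> nat" where "e \<in> M \<rightarrow>\<^sub>M count_space UNIV" "\<And>x y. (x, y) \<in> \<Gamma> \<Longrightarrow> e x \<noteq> e y"
      using borel_countable_coloring[OF \<Gamma>(3) fin] by blast
    then have "borel_chromatic_number M \<Gamma> \<le>o |UNIV :: nat set|" by (intro le) auto
    also have "|UNIV :: nat set| \<le>o |Z|" using False infinite_iff_card_of_nat by blast
    finally show ?thesis using False by (simp add: Z(1) Field_card_of)
  qed
qed

end
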